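(* Let $P_\lambda$ and $P_\mu$ be Poisson PP distributions with sigma-finite intensity measures $\lambda$ and $\mu$ on a measurable space $(S,\mathcal S)$. Then the Kullback--Leibler divergence is given by $$\mathrm{KL}(P_\lambda\|P_\mu)=\int_S\left(f\log\frac fg+g-f\right)d\nu,$$ where $f=\frac{d\lambda}{d\nu}$ and $g=\frac{d\mu}{d\nu}$ are densities with respect to a measure $\nu$.
   Context: Point patterns: $N(S)$ is the set of measures on $(S,\mathcal S)$ that can be written as a countable sum of integer-valued finite measures, equipped with the sigma-algebra $\mathcal N(S)$ generated by the evaluation maps $\eta\mapsto\eta(B)$, $B\in\mathcal S$. Poisson PP distribution: for a sigma-finite measure $\lambda$ on $(S,\mathcal S)$, $P_\lambda$ is the unique probability measure on $(N(S),\mathcal N(S))$ under which $\eta(B_1),\dots,\eta(B_n)$ are independent for all $n\ge1$ and mutually disjoint $B_1,\dots,B_n\in\mathcal S$, and $\eta(B)$ is Poisson distributed with mean $\lambda(B)$ for every $B\in\mathcal S$ (with $\mathrm{Poi}(0)=\delta_0$, $\mathrm{Poi}(\infty)=\delta_\infty$). Densities are measurable functions $f,g:S\to[0,\infty)$ with $\lambda(A)=\int_Af\,d\nu$, $\mu(A)=\int_Ag\,d\nu$ for all $A\in\mathcal S$. Conventions: $t\log\frac t0=\infty$ for $t>0$ and $0\log\frac0t=0$ for $t\ge0$. Kullback--Leibler divergence of probability measures $P,Q$: $\mathrm{KL}(P\|Q)=\int p\log\frac pq\,dm\in[0,\infty]$, where $p,q$ are densities of $P,Q$ with respect to a sigma-finite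 measure $m$, with the same conventions (the value does not depend on the choice). *)

theory Defs
  imports "HOL-Probability.Probability"
begin

section \<open>Point patterns\<close>

text \<open>
  A measure on the measurable space underlying \<open>M\<close> is one with the same \<open>sets\<close>.
  Finite and empty sums of measures are covered by padding with null measures.
\<close>

definition integer_valued_finite :: "'a measure \<Rightarrow> bool" where
  "integer_valued_finite \<xi> \<longleftrightarrow>
     finite_measure \<xi> \<and> (\<forall>A\<in>sets \<xi>. emeasure \<xi> A \<in> range (of_nat :: nat \<Rightarrow> ennreal))"

definition point_patterns :: "'a measure \<Rightarrow> 'a measure set" where
  "point_patterns M =
     {\<eta>. sets \<eta> = sets M \<and>
         (\<exists>\<xi> :: nat \<Rightarrow> 'a measure.
            (\<forall>n. sets (\<xi> n) = sets M \<and> integer_valued_finite (\<xi> n)) \<and>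
            (\<forall>A\<in>sets M. emeasure \<eta> A = (\<Sum>n. emeasure (\<xi> n) A)))}"

text \<open>
  Only the space and the sigma-algebra of the following object are meaningful
  (cf. \<^const>\<open>subprob_algebra\<close>).
\<close>

definition point_pattern_algebra :: "'a measure \<Rightarrow> 'a measure measure" where
  "point_pattern_algebra M =
     (SUP B \<in> sets M. vimage_algebra (point_patterns M) (\<lambda>\<eta>. emeasure \<eta> B) borel)"

lemma space_point_pattern_algebra: "space (point_pattern_algebra M) = point_patterns M"
  by (auto simp add: point_pattern_algebra_def space_Sup_eq_UN)

lemma point_pattern_algebra_cong:
  "sets M = sets N \<Longrightarrow> point_pattern_algebra M = point_pattern_algebra N"
  by (simp add: point_pattern_algebra_def point_patterns_def)

lemma measurable_emeasure_point_pattern_algebra: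
  "B \<in> sets M \<Longrightarrow> (\<lambda>\<eta>. emeasure \<eta> B) \<in> borel_measurable (point_pattern_algebra M)"
  by (auto intro!: measurable_Sup1 measurable_vimage_algebra1 simp: point_pattern_algebra_def)


section \<open>Poisson point pattern distributions\<close>

text \<open>
  The library's \<^const>\<open>poisson_pmf\<close> is only specified for rates in \<open>(0,\<infinity>)\<close>.
\<close>

definition poisson_ennreal :: "ennreal \<Rightarrow> ennreal measure" where
  "poisson_ennreal r =
     (if r = 0 then return borel 0
      else if r = \<infinity> then return borel \<infinity>
      else distr (measure_pmf (poisson_pmf (enn2real r))) borel of_nat)"

definition poisson_pp_dist :: "'a measure \<Rightarrow> 'a measure measure \<Rightarrow> bool" where
  "poisson_pp_dist lam P \<longleftrightarrow>
     prob_space P \<and>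
     space P = space (point_pattern_algebra lam) \<and>
     sets P = sets (point_pattern_algebra lam) \<and>
     (\<forall>n\<ge>1. \<forall>B :: nat \<Rightarrow> 'a set.
        (\<forall>i\<in>{1..n}. B i \<in> sets lam) \<and> disjoint_family_on B {1..n} \<longrightarrow>
        prob_space.indep_vars P (\<lambda>_. borel) (\<lambda>i \<eta>. emeasure \<eta> (B i)) {1..n}) \<and>
     (\<forall>B\<in>sets lam. distr P borel (\<lambda>\<eta>. emeasure \<eta> B) = poisson_ennreal (emeasure lam B))"


section \<open>Kullback--Leibler divergence\<close>

definition has_density :: "'a measure \<Rightarrow> 'a measure \<Rightarrow> ('a \<Rightarrow> real) \<Rightarrow> bool" where
  "has_density nu M f \<longleftrightarrow>
     f \<in> borel_measurable nu \<and> (\<forall>x\<in>space nu. 0 \<le> f x) \<and> M = density nu (\<lambda>x. ennreal (f x))"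

text \<open>\<open>t log (t/s)\<close> for \<open>s, t \<ge> 0\<close>, with its conventions at zero.\<close>

definition log_term :: "real \<Rightarrow> real \<Rightarrow> ereal" where
  "log_term t s = (if t = 0 then 0 else if s = 0 then \<infinity> else ereal (t * ln (t / s)))"

text \<open>
  Integral of an extended real function, as the integral of the positive part minus that of the
  negative part (\<^const>\<open>e2ennreal\<close> sends negative numbers to \<open>0\<close>). It is meaningful when at
  least one of the two is finite. This holds for the divergence of probability measures,
  since \<open>p log (p/q) \<ge> p - q\<close>.
\<close>

definition ereal_integral :: "'a measure \<Rightarrow> ('a \<Rightarrow> ereal) \<Rightarrow> ereal" where
  "ereal_integral m h =
     enn2ereal (\<integral>\<^sup>+x. e2ennreal (h x) \<partial>m) - enn2ereal (\<integral>\<^sup>+x. e2ennreal (- h x) \<partial>m)"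

text \<open>
  The value does not depend on the choice of the dominating measure or of the densities, see
  \<open>KL_div_eq\<close> and \<open>ex_dominating_measure\<close> below.
\<close>

definition KL_div :: "'a measure \<Rightarrow> 'a measure \<Rightarrow> ereal" where
  "KL_div P Q =
     (THE v. \<exists>m p q. sigma_finite_measure m \<and> has_density m P p \<and> has_density m Q q \<and>
                     v = ereal_integral m (\<lambda>x. log_term (p x) (q x)))"

lemma log_term_scale: "c \<ge> 0 \<Longrightarrow> log_term (c * a) (c * b) = ereal c * log_term a b"
  by (auto simp: log_term_def)

lemma measurable_log_term [measurable]:
  assumes [measurable]: "p \<in> borel_measurable M" "q \<in> borel_measurable M"
  shows "(\<lambda>x. log_term (p x) (q x)) \<in> borel_measurable M"
  unfolding log_term_def by measurable

lemma has_densityD: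
  assumes "has_density m M f"
  shows "f \<in> borel_measurable m" "\<And>x. x \<in> space m \<Longrightarrow> 0 \<le> f x" "sets M = sets m"
    "\<And>A. A \<in> sets m \<Longrightarrow> emeasure M A = (\<integral>\<^sup>+x\<in>A. ennreal (f x) \<partial>m)"
  using assms by (auto simp: has_density_def emeasure_density)

lemma e2ennreal_mult_real:
  assumes "c \<ge> 0"
  shows "e2ennreal (ereal c * h) = ennreal c * e2ennreal h"
proof (cases h)
  case (real r)
  then show ?thesis using assms
    by (cases "r \<ge> 0") (auto simp: ennreal_mult ennreal_neg mult_nonneg_nonpos)
next
  case PInf
  then show ?thesis using assms
    by (cases "c = 0") (auto simp: ennreal_mult_top)
next
  case MInf
  then show ?thesis using assms
    by (cases "c = 0") (auto simp: e2ennreal_neg)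
qed

lemma ereal_integral_change_reference:
  fixes p q :: "'a \<Rightarrow> real"
  assumes p: "has_density m P p" and q: "has_density m Q q"
  defines "n \<equiv> density m (\<lambda>x. ennreal (p x + q x))"
  defines "a \<equiv> (\<lambda>x. p x / (p x + q x))" and "b \<equiv> (\<lambda>x. q x / (p x + q x))"
  shows "sets n = sets P" "\<And>A. A \<in> sets P \<Longrightarrow> emeasure n A = emeasure P A + emeasure Q A"
    "has_density n P a" "has_density n Q b"
    "ereal_integral m (\<lambda>x. log_term (p x) (q x)) = ereal_integral n (\<lambda>x. log_term (a x) (b x))"
proof -
  note [measurable] = has_densityD(1)[OF p] has_densityD(1)[OF q]
  note nn = has_densityD(2)[OF p] has_densityD(2)[OF q]
  have pa: "p x = (p x + q x) * a x" "q x = (p x + q x) * b x" if "x \<in> space m" for x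
    using nn[OF that] by (auto simp: a_def b_def add_nonneg_eq_0_iff)
  have ab: "a x \<ge> 0" "b x \<ge> 0" if "x \<in> space m" for x
    using nn[OF that] by (auto simp: a_def b_def)
  have [measurable]: "a \<in> borel_measurable m" "b \<in> borel_measurable m"
    by (auto simp: a_def b_def)
  show "sets n = sets P" using has_densityD(3)[OF p] by (simp add: n_def)
  show "emeasure n A = emeasure P A + emeasure Q A" if "A \<in> sets P" for A
  proof -
    have A [measurable]: "A \<in> sets m" using that has_densityD(3)[OF p] by simp
    have "emeasure n A = (\<integral>\<^sup>+x. ennreal (p x) * indicator A x + ennreal (q x) * indicator A x \<partial>m)"
      unfolding n_def
      by (subst emeasure_density) (auto intro!: nn_integral_cong simp: nn distrib_right)
    also have "\<dots> = emeasure P A + emeasure Q A"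
      by (subst nn_integral_add) (auto simp: has_densityD(4)[OF p A] has_densityD(4)[OF q A])
    finally show ?thesis .
  qed
  have dens: "density n (\<lambda>x. ennreal (c x)) = density m (\<lambda>x. ennreal (d x))"
    if [measurable]: "c \<in> borel_measurable m" "d \<in> borel_measurable m"
      and cd: "\<And>x. x \<in> space m \<Longrightarrow> d x = (p x + q x) * c x" "\<And>x. x \<in> space m \<Longrightarrow> c x \<ge> 0" for c d
    unfolding n_def
    by (subst density_density_eq) (auto intro!: density_cong AE_I2 simp: cd nn ennreal_mult)
  show "has_density n P a" "has_density n Q b"
    using p q ab dens[of a p] dens[of b q] pa
    by (auto simp: has_density_def n_def)
  have int: "(\<integral>\<^sup>+x. e2ennreal (h (log_term (a x) (b x))) \<partial>n)
           = (\<integral>\<^sup>+x. e2ennreal (h (log_term (p x) (q x))) \<partial>m)"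
    if [measurable]: "h \<in> borel_measurable borel"
      and h: "\<And>c z. c \<ge> 0 \<Longrightarrow> h (ereal c * z) = ereal c * h z" for h :: "ereal \<Rightarrow> ereal"
  proof -
    have "(\<integral>\<^sup>+x. e2ennreal (h (log_term (a x) (b x))) \<partial>n)
        = (\<integral>\<^sup>+x. ennreal (p x + q x) * e2ennreal (h (log_term (a x) (b x))) \<partial>m)"
      unfolding n_def by (subst nn_integral_density) auto
    also have "\<dots> = (\<integral>\<^sup>+x. e2ennreal (h (log_term (p x) (q x))) \<partial>m)"
    proof (rule nn_integral_cong)
      fix x assume x: "x \<in> space m"
      have s: "p x + q x \<ge> 0" using nn[OF x] by simp
      have "log_term (p x) (q x) = ereal (p x + q x) * log_term (a x) (b x)"
        using log_term_scale[OF s] pa[OF x] by metis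
      then show "ennreal (p x + q x) * e2ennreal (h (log_term (a x) (b x)))
               = e2ennreal (h (log_term (p x) (q x)))"
        using h[OF s] e2ennreal_mult_real[OF s] by simp
    qed
    finally show ?thesis .
  qed
  show "ereal_integral m (\<lambda>x. log_term (p x) (q x)) = ereal_integral n (\<lambda>x. log_term (a x) (b x))"
    unfolding ereal_integral_def using int[of "\<lambda>x. x"] int[of uminus] by simp
qed

lemma KL_integral_unique:
  assumes P: "prob_space P" and Q: "prob_space Q"
    and 1: "has_density m P p" "has_density m Q q"
    and 2: "has_density m' P p'" "has_density m' Q q'"
  shows "ereal_integral m (\<lambda>x. log_term (p x) (q x)) = ereal_integral m' (\<lambda>x. log_term (p' x) (q' x))"
proof -
  define n where "n = density m (\<lambda>x. ennreal (p x + q x))"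
  define a b where "a = (\<lambda>x. p x / (p x + q x))" and "b = (\<lambda>x. q x / (p x + q x))"
  define a' b' where "a' = (\<lambda>x. p' x / (p' x + q' x))" and "b' = (\<lambda>x. q' x / (p' x + q' x))"
  note r1 = ereal_integral_change_reference[OF 1, folded n_def a_def b_def]
  note r2 = ereal_integral_change_reference[OF 2, folded a'_def b'_def]
  have n': "density m' (\<lambda>x. ennreal (p' x + q' x)) = n"
    using r1(1,2) r2(1,2) by (intro measure_eqI) auto
  note r2 = r2[unfolded n']
  interpret P: prob_space P by fact
  interpret Q: prob_space Q by fact
  have "space P \<in> sets P" by simp
  from r1(2)[OF this] have "emeasure n (space n) \<noteq> \<infinity>"
    using r1(1) sets_eq_imp_space_eq[OF r1(1)] by simp
  then interpret n: finite_measure n by (rule finite_measureI)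
  have ae: "AE x in n. c x = d x" if "has_density n M c" "has_density n M d" for M c d
  proof -
    have "density n (\<lambda>x. ennreal (c x)) = density n (\<lambda>x. ennreal (d x))"
      using that by (simp add: has_density_def)
    then have "AE x in n. ennreal (c x) = ennreal (d x)"
      using that by (intro n.density_unique) (auto simp: has_density_def)
    then show ?thesis
      using AE_space by eventually_elim (use that in \<open>auto simp: has_density_def\<close>)
  qed
  have "AE x in n. log_term (a x) (b x) = log_term (a' x) (b' x)"
    using ae[OF r1(3) r2(3)] ae[OF r1(4) r2(4)] by eventually_elim simp
  then have "ereal_integral n (\<lambda>x. log_term (a x) (b x)) = ereal_integral n (\<lambda>x. log_term (a' x) (b' x))"
    unfolding ereal_integral_def
    by (intro arg_cong2[where f = minus] arg_cong[where f = enn2ereal] nn_integral_cong_AE) auto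
  then show ?thesis using r1(5) r2(5) by (simp add: a_def b_def a'_def b'_def)
qed

lemma KL_div_eq:
  assumes "prob_space P" "prob_space Q" "sigma_finite_measure m" "has_density m P p" "has_density m Q q"
  shows "KL_div P Q = ereal_integral m (\<lambda>x. log_term (p x) (q x))"
  unfolding KL_div_def
  by (rule the_equality) (use assms in \<open>blast intro: KL_integral_unique\<close>)+

lemma ex_dominating_measure:
  assumes P: "prob_space P" and Q: "prob_space Q" and sets: "sets P = sets Q"
  shows "\<exists>m p q. sigma_finite_measure m \<and> has_density m P p \<and> has_density m Q q"
proof -
  interpret P: prob_space P by fact
  interpret Q: prob_space Q by fact
  define m where "m = measure_of (space P) (sets P) (\<lambda>A. emeasure P A + emeasure Q A)"
  have sm: "sets m = sets P" "space m = space P" by (auto simp: m_def)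
  have em: "emeasure m A = emeasure P A + emeasure Q A" if "A \<in> sets P" for A
  proof (rule emeasure_measure_of[OF m_def])
    show "sets P \<subseteq> Pow (space P)" by (rule sets.space_closed)
    show "A \<in> sets m" using that sm by simp
    show "positive (sets m) (\<lambda>A. emeasure P A + emeasure Q A)" by (simp add: positive_def)
    show "countably_additive (sets m) (\<lambda>A. emeasure P A + emeasure Q A)"
      unfolding countably_additive_def
    proof safe
      fix A :: "nat \<Rightarrow> 'a set" assume A: "range A \<subseteq> sets m" "disjoint_family A"
      have "(\<Sum>i. emeasure P (A i) + emeasure Q (A i))
          = (\<Sum>i. emeasure P (A i)) + (\<Sum>i. emeasure Q (A i))"
        by (intro suminf_add[symmetric]) auto
      then show "(\<Sum>i. emeasure P (A i) + emeasure Q (A i)) = emeasure P (\<Union>(range A)) + emeasure Q (\<Union>(range A))"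
        using A sm sets by (simp add: suminf_emeasure)
    qed
  qed
  have "emeasure m (space m) \<noteq> \<infinity>" using em sm by simp
  then interpret m: finite_measure m by (rule finite_measureI)
  have ex: "\<exists>p. has_density m M p"
    if M: "prob_space M" "sets M = sets P" "\<And>A. A \<in> sets P \<Longrightarrow> emeasure m A = 0 \<Longrightarrow> emeasure M A = 0" for M
  proof -
    interpret M: prob_space M by fact
    have ac: "absolutely_continuous m M"
      using M sm by (auto simp: absolutely_continuous_def null_sets_def)
    obtain D where D: "D \<in> borel_measurable m" "AE x in m. RN_deriv m M x = ennreal (D x)" 
      "AE x in M. 0 < D x" "\<And>x. 0 \<le> D x"
      using m.real_RN_deriv[OF M.finite_measure_axioms ac] M(2) sm by metis
    have "density m (RN_deriv m M) = M"
      by (rule m.density_RN_deriv) (use ac M(2) sm in auto)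
    moreover have "density m (RN_deriv m M) = density m (\<lambda>x. ennreal (D x))"
      using D by (intro density_cong) auto
    ultimately have "has_density m M D" using D by (auto simp: has_density_def)
    then show ?thesis by blast
  qed
  from ex[OF P] ex[OF Q] em sets show ?thesis
    using m.sigma_finite_measure_axioms by (metis add_eq_0_iff_both_eq_0)
qed

end

theory Submission
  imports Defs
begin

text \<open>
  By Young's inequality \<open>a log (a / b) + b - a = sup\<^sub>t (t a - (exp t - 1) b)\<close>, so the integral of this
  expression is the supremum of \<open>\<Sum>i. t\<^sub>i \<lambda>(A\<^sub>i) - (exp t\<^sub>i - 1) \<mu>(A\<^sub>i)\<close> over finite disjoint families of
  sets of finite measure. This holds for the intensities and for the two point process laws alike.

  Lower bound: apply Young's inequality to the densities of the laws with
  \<open>t = X - log E\<^sub>\<mu> (exp X)\<close>, where \<open>X = \<Sum>i. t\<^sub>i \<eta>(A\<^sub>i)\<close>; since \<open>E\<^sub>\<lambda> X = \<Sum>i. t\<^sub>i \<lambda>(A\<^sub>i)\<close> and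
  \<open>log E\<^sub>\<mu> (exp X) = \<Sum>i. (exp t\<^sub>i - 1) \<mu>(A\<^sub>i)\<close>, the terms of the supremum appear.

  Upper bound: events in the variational formula for the laws can be approximated by cylinder events
  over finitely many disjoint sets \<open>D\<^sub>i\<close>. There the laws are products of Poisson distributions, and the
  bound is the sum of the divergences of \<open>Poi(\<lambda>(D\<^sub>i))\<close> from \<open>Poi(\<mu>(D\<^sub>i))\<close>, each at most the integral over
  \<open>D\<^sub>i\<close> by Young's inequality again.
\<close>

section \<open>The integrand as a supremum\<close>

text \<open>For nonnegative arguments the truncation by \<open>e2ennreal\<close> loses nothing,
  because the expression is nonnegative by Young's inequality (\<open>kl_term_nonneg\<close>). Only
  the logarithmic term can be infinite, so no difference of infinities arises, and the integral
  always makes sense as a nonnegative one.\<close>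

definition kl_term :: "real \<Rightarrow> real \<Rightarrow> ennreal" where
  "kl_term a b = e2ennreal (log_term a b + ereal b - ereal a)"

text \<open>For \<open>a, b > 0\<close> this is \<open>1 + y \<le> exp y\<close> at
  \<open>y = t - ln (a / b)\<close>, multiplied by \<open>a\<close>. For \<open>a = 0\<close> it
  says \<open>exp t * b \<ge> 0\<close>, and for \<open>a > 0 = b\<close> the right-hand side is
  infinite.\<close>

lemma kl_term_young_ereal:
  assumes "a \<ge> 0" "b \<ge> 0"
  shows "ereal (t * a - (exp t - 1) * b) \<le> log_term a b + ereal b - ereal a"
proof -
  consider "a = 0" | "a > 0" "b = 0" | "a > 0" "b > 0" using assms by fastforce
  then show ?thesis
  proof cases
    case 3
    have "1 + (t - ln (a / b)) \<le> exp (t - ln (a / b))" by (rule exp_ge_add_one_self)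
    also have "\<dots> = exp t * b / a" using 3 by (simp add: exp_diff)
    finally have "a * (1 + (t - ln (a / b))) \<le> a * (exp t * b / a)" using 3 by (simp only: mult_le_cancel_left_pos)
    then have "t * a - (exp t - 1) * b \<le> a * ln (a / b) + b - a" using 3 by (simp add: algebra_simps)
    then show ?thesis using 3 by (simp add: log_term_def)
  qed (use assms in \<open>auto simp: log_term_def algebra_simps zero_ereal_def[symmetric]\<close>)
qed

lemma kl_term_nonneg: "a \<ge> 0 \<Longrightarrow> b \<ge> 0 \<Longrightarrow> 0 \<le> log_term a b + ereal b - ereal a"
  using kl_term_young_ereal[of a b 0] by (simp add: zero_ereal_def)

lemma kl_term_young:
  "a \<ge> 0 \<Longrightarrow> b \<ge> 0 \<Longrightarrow> ennreal (t * a - (exp t - 1) * b) \<le> kl_term a b"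
  using e2ennreal_mono[OF kl_term_young_ereal[of a b t]] by (simp add: kl_term_def)

lemma measurable_kl_term [measurable]:
  assumes [measurable]: "p \<in> borel_measurable M" "q \<in> borel_measurable M"
  shows "(\<lambda>x. kl_term (p x) (q x)) \<in> borel_measurable M"
  unfolding kl_term_def by measurable

text \<open>The supremum over all real \<open>t\<close> is attained at \<open>ln (a / b)\<close> if
  both numbers are positive, and is approached as \<open>t\<close> tends to minus infinity if
  \<open>a = 0\<close> and to infinity if \<open>b = 0 < a\<close>. A countable dense set of
  \<open>t\<close> is enough by continuity; countability allows monotone convergence in
  \<open>kl_integral_le\<close>.\<close>

lemma kl_term_le_SUP:
  fixes t :: "nat \<Rightarrow> real"
  assumes ab: "a \<ge> 0" "b \<ge> 0" and t: "closure (range t) = UNIV"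
  shows "kl_term a b \<le> (SUP n. ennreal (t n * a - (exp (t n) - 1) * b))" (is "_ \<le> ?S")
proof -
  define \<phi> where "\<phi> = (\<lambda>t. t * a - (exp t - 1) * b)"
  \<comment> \<open>The bound by \<open>?S\<close> holds on a dense set and defines a closed set, so
    it holds for every real \<open>t\<close>.\<close>
  have "closed {t. ennreal (\<phi> t) \<le> ?S}"
    unfolding \<phi>_def by (intro closed_Collect_le continuous_on_ennreal continuous_intros)
  moreover have "range t \<subseteq> {t. ennreal (\<phi> t) \<le> ?S}"
    by (auto simp: \<phi>_def intro!: SUP_upper2)
  ultimately have le: "ennreal (\<phi> s) \<le> ?S" for s
    using closure_minimal[of "range t" "{t. ennreal (\<phi> t) \<le> ?S}"] t by auto
  consider "a = 0" | "a > 0" "b = 0" | "a > 0" "b > 0" using ab by fastforce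
  then show ?thesis
  proof cases
    case 1
    have "((\<lambda>t. ennreal (\<phi> t)) \<longlongrightarrow> ennreal (0 - (0 - 1) * b)) at_bot"
      unfolding \<phi>_def 1 mult_zero_right
      by (intro tendsto_ennrealI tendsto_intros exp_at_bot)
    then have "ennreal b \<le> ?S"
      using le by (intro tendsto_upperbound[of _ _ at_bot]) auto
    then show ?thesis using 1 by (simp add: kl_term_def log_term_def)
  next
    case 2
    have "ennreal (of_nat n) \<le> ?S" for n
      using le[of "real n / a"] 2 by (simp add: \<phi>_def)
    then have "?S = \<top>"
      by (metis ennreal_Ex_less_of_nat ennreal_of_nat_eq_real_of_nat less_top not_le)
    then show ?thesis by (simp only: top_greatest)
  next
    case 3
    then have "kl_term a b = ennreal (\<phi> (ln (a / b)))"
      by (simp add: kl_term_def log_term_def \<phi>_def field_simps)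
    then show ?thesis using le by simp
  qed
qed

lemma ex_dense_real_sequence: "\<exists>t :: nat \<Rightarrow> real. closure (range t) = UNIV"
proof -
  have "range (from_nat_into \<rat> :: nat \<Rightarrow> real) = \<rat>"
    by (rule range_from_nat_into) (auto simp: countable_rat)
  then show ?thesis using Rats_closure_real by metis
qed

section \<open>Young's inequality and its supremum under the integral\<close>

lemma set_integral_density:
  assumes f: "has_density m M f" and A: "A \<in> sets m" and fin: "emeasure M A < \<infinity>"
  shows "integrable m (\<lambda>x. indicator A x * f x)" "(\<integral>x. indicator A x * f x \<partial>m) = measure M A"
proof -
  note [measurable] = has_densityD(1)[OF f] A
  have nn: "AE x in m. 0 \<le> indicator A x * f x"
    using has_densityD(2)[OF f] by (auto simp: indicator_def)
  have eq: "(\<integral>\<^sup>+x. ennreal (indicator A x * f x) \<partial>m) = emeasure M A"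
    unfolding has_densityD(4)[OF f A]
    by (intro nn_integral_cong) (auto simp: indicator_def)
  show "integrable m (\<lambda>x. indicator A x * f x)"
    using nn eq fin by (intro integrableI_nonneg) auto
  show "(\<integral>x. indicator A x * f x \<partial>m) = measure M A"
    using nn eq by (subst integral_eq_nn_integral) (auto simp: measure_def)
qed

text \<open>A maximum of finitely many functions \<open>t i * f - (exp (t i) - 1) * g\<close> is
  integrated by splitting the space according to which of them is largest; on each cell the integral
  is linear in the two masses. The lemma serves twice: for the intensities in the lower bound and
  for the laws in the upper bound.\<close>

lemma kl_integral_le:
  assumes f: "has_density nu lam f" and g: "has_density nu mu g"
    and "sigma_finite_measure lam" "sigma_finite_measure mu"
    and le: "\<And>(n::nat) A t. (\<And>i. i \<le> n \<Longrightarrow> A i \<in> sets nu) \<Longrightarrow> (\<And>i. i \<le> n \<Longrightarrow> emeasure lam (A i) < \<infinity>) \<Longrightarrow>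
      (\<And>i. i \<le> n \<Longrightarrow> emeasure mu (A i) < \<infinity>) \<Longrightarrow> disjoint_family_on A {..n} \<Longrightarrow>
      ennreal (\<Sum>i\<le>n. t i * measure lam (A i) - (exp (t i) - 1) * measure mu (A i)) \<le> C"
  shows "(\<integral>\<^sup>+x. kl_term (f x) (g x) \<partial>nu) \<le> C"
proof -
  interpret lam: sigma_finite_measure lam by fact
  interpret mu: sigma_finite_measure mu by fact
  note fm [measurable] = has_densityD(1)[OF f] and gm [measurable] = has_densityD(1)[OF g]
  have sl: "sets lam = sets nu" "space lam = space nu" and sm: "sets mu = sets nu" "space mu = space nu"
    using has_densityD(3)[OF f] has_densityD(3)[OF g] by (auto dest: sets_eq_imp_space_eq)
  obtain U :: "nat \<Rightarrow> 'a set" where U: "range U \<subseteq> sets lam" "(\<Union>i. U i) = space lam"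
    "\<And>i. emeasure lam (U i) \<noteq> \<infinity>" "incseq U" by (rule lam.sigma_finite_incseq) blast
  obtain V :: "nat \<Rightarrow> 'a set" where V: "range V \<subseteq> sets mu" "(\<Union>i. V i) = space mu"
    "\<And>i. emeasure mu (V i) \<noteq> \<infinity>" "incseq V" by (rule mu.sigma_finite_incseq) blast
  have UVm [measurable]: "U i \<in> sets nu" "V i \<in> sets nu" for i using U(1) V(1) sl sm by auto
  obtain t :: "nat \<Rightarrow> real" where t: "closure (range t) = UNIV" using ex_dense_real_sequence by blast
  define \<phi> where "\<phi> = (\<lambda>i x. t i * f x - (exp (t i) - 1) * g x)"
  have [measurable]: "\<phi> i \<in> borel_measurable nu" for i by (simp add: \<phi>_def)
  \<comment> \<open>The first \<open>k + 1\<close> functions are used on a set of finite mass under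
    both measures. These \<open>h k\<close> increase to a majorant of
    \<open>kl_term (f x) (g x)\<close>, so it suffices to bound each of their integrals.\<close>
  define h where "h = (\<lambda>k x. indicator (U k \<inter> V k) x * (SUP j\<in>{..k}. ennreal (\<phi> j x)))"
  have [measurable]: "h k \<in> borel_measurable nu" for k unfolding h_def by measurable
  have "incseq h"
  proof (intro incseq_SucI le_funI)
    fix k x
    have "indicator (U k \<inter> V k) x \<le> (indicator (U (Suc k) \<inter> V (Suc k)) x :: ennreal)"
      using incseqD[OF U(4), of k "Suc k"] incseqD[OF V(4), of k "Suc k"] by (auto simp: indicator_def)
    moreover have "(SUP j\<in>{..k}. ennreal (\<phi> j x)) \<le> (SUP j\<in>{..Suc k}. ennreal (\<phi> j x))"
      by (intro SUP_subset_mono) auto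
    ultimately show "h k x \<le> h (Suc k) x" unfolding h_def by (intro mult_mono) auto
  qed
  have "kl_term (f x) (g x) \<le> (SUP k. h k x)" if x: "x \<in> space nu" for x
  proof -
    have "ennreal (\<phi> n x) \<le> (SUP k. h k x)" for n
    proof -
      obtain i j where ij: "x \<in> U i" "x \<in> V j" using x U(2) V(2) sl sm by (metis UN_E)
      define k where "k = n + i + j"
      have "x \<in> U k \<inter> V k"
        using ij incseqD[OF U(4), of i k] incseqD[OF V(4), of j k] by (auto simp: k_def)
      then have "h k x = (SUP j\<in>{..k}. ennreal (\<phi> j x))" by (simp add: h_def)
      then have "ennreal (\<phi> n x) \<le> h k x" by (auto intro!: SUP_upper simp: k_def)
      then show ?thesis by (rule SUP_upper2[rotated]) auto
    qed
    then have "(SUP n. ennreal (\<phi> n x)) \<le> (SUP k. h k x)" by (rule SUP_least)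
    with kl_term_le_SUP[OF _ _ t] show ?thesis
      using x has_densityD(2)[OF f] has_densityD(2)[OF g] unfolding \<phi>_def by (meson order_trans)
  qed
  then have "(\<integral>\<^sup>+x. kl_term (f x) (g x) \<partial>nu) \<le> (\<integral>\<^sup>+x. (SUP k. h k x) \<partial>nu)"
    by (intro nn_integral_mono)
  also have "\<dots> = (SUP k. \<integral>\<^sup>+x. h k x \<partial>nu)"
    by (intro nn_integral_monotone_convergence_SUP \<open>incseq h\<close>) auto
  also have "\<dots> \<le> C"
  proof (rule SUP_least)
    fix k
    \<comment> \<open>\<open>A i\<close> collects the points at which \<open>i\<close> is the least
      index of a maximal \<open>\<phi> i\<close>; breaking ties this way makes the cells disjoint.
      Points where all these values are negative lie in no cell, in accordance with
      \<open>h k\<close> being \<open>0\<close> there.\<close>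
    define A where "A = (\<lambda>i. {x \<in> space nu. x \<in> U k \<and> x \<in> V k \<and> 0 \<le> \<phi> i x \<and>
        (\<forall>j\<in>{..k}. \<phi> j x \<le> \<phi> i x) \<and> (\<forall>j\<in>{..<i}. \<phi> j x < \<phi> i x)})"
    have [measurable]: "A i \<in> sets nu" for i unfolding A_def by measurable
    have disj: "disjoint_family_on A {..k}"
      unfolding disjoint_family_on_def
    proof (intro ballI impI)
      have *: "A i \<inter> A j = {}" if "i < j" "j \<le> k" for i j
      proof -
        have "\<phi> i x < \<phi> j x" if "x \<in> A j" for x using that \<open>i < j\<close> by (simp add: A_def)
        moreover have "\<phi> j x \<le> \<phi> i x" if "x \<in> A i" for x using that \<open>j \<le> k\<close> by (simp add: A_def)
        ultimately show ?thesis by fastforce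
      qed
      show "A i \<inter> A j = {}" if "i \<in> {..k}" "j \<in> {..k}" "i \<noteq> j" for i j
        using that *[of i j] *[of j i] by (metis Int_commute atMost_iff nat_neq_iff)
    qed
    have fin: "emeasure lam (A i) < \<infinity>" "emeasure mu (A i) < \<infinity>" for i
    proof -
      have "emeasure lam (A i) \<le> emeasure lam (U k)" "emeasure mu (A i) \<le> emeasure mu (V k)"
        using UVm by (auto intro!: emeasure_mono simp: A_def sl sm)
      then show "emeasure lam (A i) < \<infinity>" "emeasure mu (A i) < \<infinity>"
        using U(3) V(3) by (auto simp: less_top[symmetric] top_unique)
    qed
    have nn: "0 \<le> indicator (A i) x * \<phi> i x" for i x by (auto simp: A_def indicator_def)
    have "h k x \<le> (\<Sum>i\<le>k. ennreal (indicator (A i) x * \<phi> i x))" if x: "x \<in> space nu" for x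
    proof (cases "x \<in> U k \<inter> V k \<and> (\<exists>j\<le>k. 0 \<le> \<phi> j x)")
      case False
      have "h k x \<le> 0"
      proof (cases "x \<in> U k \<inter> V k")
        case True
        with False have "ennreal (\<phi> j x) \<le> 0" if "j \<le> k" for j
          using that by (metis ennreal_neg not_le order.strict_implies_order order_refl)
        then have "(SUP j\<in>{..k}. ennreal (\<phi> j x)) \<le> 0" by (intro SUP_least) simp
        then show ?thesis using True by (simp add: h_def)
      qed (simp add: h_def)
      then show ?thesis by (rule order_trans) simp
    next
      case True
      define P where "P = (\<lambda>i. i \<le> k \<and> (\<forall>j\<in>{..k}. \<phi> j x \<le> \<phi> i x))"
      have "finite ((\<lambda>j. \<phi> j x) ` {..k})" "(\<lambda>j. \<phi> j x) ` {..k} \<noteq> {}" by auto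
      then obtain i where "i \<le> k" "\<phi> i x = Max ((\<lambda>j. \<phi> j x) ` {..k})"
        using Max_in by (metis (no_types, lifting) atMost_iff imageE)
      then have "P i" using Max_ge[OF \<open>finite _\<close>] by (simp add: P_def)
      define m where "m = (LEAST i. P i)"
      have "P m" unfolding m_def by (rule LeastI) fact
      have "\<phi> j x < \<phi> m x" if "j < m" for j
      proof (rule ccontr)
        assume "\<not> \<phi> j x < \<phi> m x"
        with \<open>P m\<close> that have "P j" by (auto simp: P_def intro: order_trans)
        with that show False unfolding m_def by (metis not_less_Least)
      qed
      moreover have "0 \<le> \<phi> m x" using True \<open>P m\<close> unfolding P_def by (meson atMost_iff order_trans)
      ultimately have "x \<in> A m" using \<open>P m\<close> True x by (simp add: A_def P_def)
      have "h k x \<le> ennreal (\<phi> m x)"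
        using \<open>P m\<close> True unfolding h_def P_def by (simp add: SUP_le_iff ennreal_leI)
      also have "\<dots> = ennreal (indicator (A m) x * \<phi> m x)" using \<open>x \<in> A m\<close> by simp
      also have "\<dots> \<le> (\<Sum>i\<le>k. ennreal (indicator (A i) x * \<phi> i x))"
        using \<open>P m\<close> by (intro member_le_sum) (auto simp: P_def)
      finally show ?thesis .
    qed
    then have "(\<integral>\<^sup>+x. h k x \<partial>nu) \<le> (\<integral>\<^sup>+x. (\<Sum>i\<le>k. ennreal (indicator (A i) x * \<phi> i x)) \<partial>nu)"
      by (rule nn_integral_mono)
    also have "\<dots> = (\<integral>\<^sup>+x. ennreal (\<Sum>i\<le>k. indicator (A i) x * \<phi> i x) \<partial>nu)"
      using nn by simp
    also have "\<dots> = ennreal (\<integral>x. (\<Sum>i\<le>k. indicator (A i) x * \<phi> i x) \<partial>nu)"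
    proof (rule nn_integral_eq_integral)
      show "integrable nu (\<lambda>x. \<Sum>i\<le>k. indicator (A i) x * \<phi> i x)"
      proof (rule Bochner_Integration.integrable_sum)
        fix i
        have "integrable nu (\<lambda>x. t i * (indicator (A i) x * f x) - (exp (t i) - 1) * (indicator (A i) x * g x))"
          using set_integral_density(1)[OF f _ fin(1)] set_integral_density(1)[OF g _ fin(2)]
          by (intro Bochner_Integration.integrable_diff integrable_mult_right) auto
        then show "integrable nu (\<lambda>x. indicator (A i) x * \<phi> i x)" by (simp add: \<phi>_def algebra_simps)
      qed
    next
      show "AE x in nu. 0 \<le> (\<Sum>i\<le>k. indicator (A i) x * \<phi> i x)"
        using nn by (intro AE_I2 sum_nonneg)
    qed
    also have "(\<integral>x. (\<Sum>i\<le>k. indicator (A i) x * \<phi> i x) \<partial>nu)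
        = (\<integral>x. (\<Sum>i\<le>k. t i * (indicator (A i) x * f x) - (exp (t i) - 1) * (indicator (A i) x * g x)) \<partial>nu)"
      by (intro Bochner_Integration.integral_cong sum.cong) (auto simp: \<phi>_def algebra_simps)
    also have "\<dots> = (\<Sum>i\<le>k. t i * measure lam (A i) - (exp (t i) - 1) * measure mu (A i))"
      by (subst Bochner_Integration.integral_sum) 
        (auto intro!: set_integral_density(1)[OF f _ fin(1)] set_integral_density(1)[OF g _ fin(2)]
           simp: Bochner_Integration.integral_diff set_integral_density[OF f _ fin(1)] set_integral_density[OF g _ fin(2)])
    also have "ennreal \<dots> \<le> C"
      using fin disj by (intro le) auto
    finally show "(\<integral>\<^sup>+x. h k x \<partial>nu) \<le> C" .
  qed
  finally show ?thesis .
qed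

text \<open>This is Young's inequality at \<open>t\<close> and at \<open>- t\<close>, integrated
  over \<open>D\<close>. The negative term stands on the other side, so that the estimates remain
  meaningful when \<open>D\<close> has infinite mass.\<close>

lemma kl_set_integral_ge:
  assumes f: "has_density nu lam f" and g: "has_density nu mu g" and D [measurable]: "D \<in> sets nu"
    and "t \<ge> 0"
  shows "ennreal t * emeasure lam D \<le> (\<integral>\<^sup>+x\<in>D. kl_term (f x) (g x) \<partial>nu) + ennreal (exp t - 1) * emeasure mu D"
    and "ennreal (1 - exp (- t)) * emeasure mu D \<le> (\<integral>\<^sup>+x\<in>D. kl_term (f x) (g x) \<partial>nu) + ennreal t * emeasure lam D"
proof -
  note fm [measurable] = has_densityD(1)[OF f] and gm [measurable] = has_densityD(1)[OF g]
  note nn = has_densityD(2)[OF f] has_densityD(2)[OF g]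
  \<comment> \<open>The pointwise form: \<open>r\<close> is the positive and \<open>s\<close> the
    negative part of the Young expression at \<open>u\<close>. It is used with \<open>u = t\<close>
    and with \<open>u = - t\<close>, where \<open>f\<close> and \<open>g\<close> exchange
    roles.\<close>
  have *: "ennreal r \<le> kl_term (f x) (g x) + ennreal s"
    if "x \<in> space nu" "s \<ge> 0" "r - s = u * f x - (exp u - 1) * g x" for r s u x
  proof -
    have "ennreal r \<le> ennreal (r - s) + ennreal s"
      using that by (cases "r \<ge> s") (auto simp: ennreal_plus[symmetric] ennreal_neg ennreal_leI simp del: ennreal_plus)
    also have "ennreal (r - s) \<le> kl_term (f x) (g x)"
      unfolding that(3) using nn that(1) by (intro kl_term_young)
    finally show ?thesis by (simp add: add_mono)
  qed
  have "ennreal t * emeasure lam D = (\<integral>\<^sup>+x\<in>D. ennreal (t * f x) \<partial>nu)"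
    using \<open>t \<ge> 0\<close> unfolding has_densityD(4)[OF f D]
    by (subst nn_integral_cmult[symmetric]) (auto intro!: nn_integral_cong simp: ennreal_mult nn mult.assoc)
  also have "\<dots> \<le> (\<integral>\<^sup>+x. kl_term (f x) (g x) * indicator D x + ennreal (exp t - 1) * (ennreal (g x) * indicator D x) \<partial>nu)"
    using \<open>t \<ge> 0\<close> nn
    by (intro nn_integral_mono) (auto simp: indicator_def ennreal_mult[symmetric] intro!: *[where u=t])
  also have "\<dots> = (\<integral>\<^sup>+x\<in>D. kl_term (f x) (g x) \<partial>nu) + ennreal (exp t - 1) * emeasure mu D"
    unfolding has_densityD(4)[OF g D] by (simp add: nn_integral_add nn_integral_cmult)
  finally show "ennreal t * emeasure lam D \<le> (\<integral>\<^sup>+x\<in>D. kl_term (f x) (g x) \<partial>nu) + ennreal (exp t - 1) * emeasure mu D" .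
  have le: "ennreal ((1 - exp (- t)) * g x) \<le> kl_term (f x) (g x) + ennreal (t * f x)" if "x \<in> space nu" for x
    using that nn \<open>t \<ge> 0\<close> by (intro *[where u = "- t"]) (auto simp: algebra_simps)
  have "ennreal (1 - exp (- t)) * emeasure mu D = (\<integral>\<^sup>+x\<in>D. ennreal ((1 - exp (- t)) * g x) \<partial>nu)"
    using \<open>t \<ge> 0\<close> unfolding has_densityD(4)[OF g D]
    by (subst nn_integral_cmult[symmetric]) (auto intro!: nn_integral_cong simp: ennreal_mult nn mult.assoc)
  also have "\<dots> \<le> (\<integral>\<^sup>+x. kl_term (f x) (g x) * indicator D x + ennreal t * (ennreal (f x) * indicator D x) \<partial>nu)"
    using \<open>t \<ge> 0\<close> nn
    by (intro nn_integral_mono) (auto simp: indicator_def ennreal_mult[symmetric] intro!: le)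
  also have "\<dots> = (\<integral>\<^sup>+x\<in>D. kl_term (f x) (g x) \<partial>nu) + ennreal t * emeasure lam D"
    unfolding has_densityD(4)[OF f D] by (simp add: nn_integral_add nn_integral_cmult)
  finally show "ennreal (1 - exp (- t)) * emeasure mu D \<le> (\<integral>\<^sup>+x\<in>D. kl_term (f x) (g x) \<partial>nu) + ennreal t * emeasure lam D" .
qed

section \<open>The divergence as the integral of a nonnegative function\<close>

lemma ereal_integral_kl_term:
  assumes f: "has_density nu lam f" and g: "has_density nu mu g"
  shows "ereal_integral nu (\<lambda>x. log_term (f x) (g x) + ereal (g x) - ereal (f x))
    = enn2ereal (\<integral>\<^sup>+x. kl_term (f x) (g x) \<partial>nu)"
proof -
  have "(\<integral>\<^sup>+x. e2ennreal (- (log_term (f x) (g x) + ereal (g x) - ereal (f x))) \<partial>nu) = (\<integral>\<^sup>+x. 0 \<partial>nu)"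
  proof (intro nn_integral_cong e2ennreal_neg)
    fix x assume "x \<in> space nu"
    then show "- (log_term (f x) (g x) + ereal (g x) - ereal (f x)) \<le> 0"
      using kl_term_nonneg[of "f x" "g x"] has_densityD(2)[OF f] has_densityD(2)[OF g]
      by (simp add: ereal_uminus_le_0_iff)
  qed
  then show ?thesis by (simp add: ereal_integral_def kl_term_def zero_ennreal.rep_eq)
qed

text \<open>The correction \<open>q - p\<close> has integral \<open>0\<close>, both densities having
  total mass \<open>1\<close>. As the divergence may be infinite, the cancellation is done in
  \<open>ennreal\<close>, on positive and negative parts separately.\<close>

lemma KL_div_eq_kl_term:
  assumes P: "prob_space P" and Q: "prob_space Q" and m: "sigma_finite_measure m"
    and p: "has_density m P p" and q: "has_density m Q q"
  shows "KL_div P Q = enn2ereal (\<integral>\<^sup>+x. kl_term (p x) (q x) \<partial>m)"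
proof -
  interpret P: prob_space P by fact
  interpret Q: prob_space Q by fact
  note pm [measurable] = has_densityD(1)[OF p] and qm [measurable] = has_densityD(1)[OF q]
  note nn = has_densityD(2)[OF p] has_densityD(2)[OF q]
  have sets: "sets P = sets m" "sets Q = sets m" "space P = space m" "space Q = space m"
    using has_densityD(3)[OF p] has_densityD(3)[OF q] by (auto dest: sets_eq_imp_space_eq)
  have int1: "(\<integral>\<^sup>+x. ennreal (p x) \<partial>m) = 1" "(\<integral>\<^sup>+x. ennreal (q x) \<partial>m) = 1"
    using has_densityD(4)[OF p, of "space m"] has_densityD(4)[OF q, of "space m"]
      P.emeasure_space_1 Q.emeasure_space_1 sets
      nn_integral_indicator'[symmetric, of "space m" m]
    by (simp_all cong: nn_integral_cong_simp)
  define A B H where "A = (\<integral>\<^sup>+x. e2ennreal (log_term (p x) (q x)) \<partial>m)"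
    and "B = (\<integral>\<^sup>+x. e2ennreal (- log_term (p x) (q x)) \<partial>m)"
    and "H = (\<integral>\<^sup>+x. kl_term (p x) (q x) \<partial>m)"
  \<comment> \<open>\<open>L + b = (L + b - a) + a\<close> with the negative part of
    \<open>L\<close> moved to the right, so that all summands are nonnegative.\<close>
  have pw: "e2ennreal L + ennreal b = e2ennreal (L + ereal b - ereal a) + (e2ennreal (- L) + ennreal a)"
    if "0 \<le> L + ereal b - ereal a" "a \<ge> 0" "b \<ge> 0" for L a b
    using that by (cases L; cases "real_of_ereal L \<ge> 0")
      (auto simp: ennreal_plus[symmetric] ennreal_neg simp del: ennreal_plus)
  have "A + 1 = (\<integral>\<^sup>+x. e2ennreal (log_term (p x) (q x)) + ennreal (q x) \<partial>m)"
    unfolding A_def int1(2)[symmetric] by (rule nn_integral_add[symmetric]) auto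
  also have "\<dots> = (\<integral>\<^sup>+x. kl_term (p x) (q x) + (e2ennreal (- log_term (p x) (q x)) + ennreal (p x)) \<partial>m)"
    unfolding kl_term_def by (intro nn_integral_cong pw kl_term_nonneg nn)
  also have "\<dots> = H + (B + 1)"
    unfolding H_def B_def int1(1)[symmetric] by (simp add: nn_integral_add)
  finally have AB: "A = H + B" by (simp add: add.assoc[symmetric])
  \<comment> \<open>Finiteness of \<open>B\<close> is what permits subtracting it from
    \<open>A = H + B\<close>. It holds because the negative part of the logarithmic term is at most
    \<open>q\<close>.\<close>
  have "B \<le> (\<integral>\<^sup>+x. ennreal (q x) \<partial>m)" unfolding B_def
  proof (rule nn_integral_mono)
    fix x assume "x \<in> space m"
    with nn have *: "0 \<le> log_term (p x) (q x) + ereal (q x) - ereal (p x)" "p x \<ge> 0"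
      by (auto intro: kl_term_nonneg)
    then have "- log_term (p x) (q x) \<le> ereal (q x)" by (cases "log_term (p x) (q x)") auto
    from e2ennreal_mono[OF this] show "e2ennreal (- log_term (p x) (q x)) \<le> ennreal (q x)" by simp
  qed
  also have "\<dots> < \<infinity>" by (simp add: int1)
  finally obtain b where b: "B = ennreal b" "b \<ge> 0" by (cases B) auto
  have "KL_div P Q = enn2ereal A - enn2ereal B"
    using KL_div_eq[OF P Q m p q] by (simp add: ereal_integral_def A_def B_def)
  also have "\<dots> = enn2ereal H"
    unfolding AB b(1) by (cases H) (use b in \<open>auto simp: ennreal_plus[symmetric] simp del: ennreal_plus\<close>)
  finally show ?thesis by (simp add: H_def)
qed

section \<open>Poisson distributions\<close>

lemma sets_poisson_ennreal [simp, measurable_cong]: "sets (poisson_ennreal r) = sets borel"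
  by (simp add: poisson_ennreal_def)

lemma space_poisson_ennreal [simp]: "space (poisson_ennreal r) = UNIV"
  by (simp add: poisson_ennreal_def)

lemma prob_space_poisson_ennreal: "prob_space (poisson_ennreal r)"
  by (auto simp: poisson_ennreal_def intro!: prob_space_return measure_pmf.prob_space_distr)

text \<open>Since \<open>0 ^ 0 = 1\<close>, the usual series also describes the point mass at
  \<open>0\<close>, so the moment computations below need no case distinction for
  \<open>r = 0\<close>.\<close>

lemma nn_integral_poisson_ennreal:
  assumes [measurable]: "u \<in> borel_measurable borel" and r: "r \<ge> 0"
  shows "(\<integral>\<^sup>+x. u x \<partial>poisson_ennreal (ennreal r))
    = (\<Sum>k. ennreal (r ^ k / fact k * exp (- r)) * u (of_nat k))"
proof (cases "r = 0")
  case True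
  have "(\<Sum>k. ennreal (r ^ k / fact k * exp (- r)) * u (of_nat k)) = (\<Sum>k\<in>{0}. ennreal (r ^ k / fact k * exp (- r)) * u (of_nat k))"
    by (intro suminf_finite) (auto simp: True)
  then show ?thesis using True by (simp add: poisson_ennreal_def nn_integral_return)
next
  case False
  then have "(\<integral>\<^sup>+x. u x \<partial>poisson_ennreal (ennreal r)) = (\<integral>\<^sup>+k. u (of_nat k) \<partial>measure_pmf (poisson_pmf r))"
    using r by (simp add: poisson_ennreal_def nn_integral_distr)
  also have "\<dots> = (\<Sum>k. ennreal (r ^ k / fact k * exp (- r)) * u (of_nat k))"
    using False r by (simp add: nn_integral_measure_pmf nn_integral_count_space_nat)
  finally show ?thesis .
qed

text \<open>The exponential series at \<open>r * exp t\<close> gives the moment generating function.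
  Its exponent \<open>(exp t - 1) * r\<close> is the term that Young's inequality subtracts.\<close>

lemma poisson_ennreal_exp:
  assumes r: "r \<ge> 0"
  shows "(\<integral>\<^sup>+x. ennreal (exp (t * enn2real x)) \<partial>poisson_ennreal (ennreal r)) = ennreal (exp ((exp t - 1) * r))"
proof -
  have "(\<lambda>k. (r * exp t) ^ k /\<^sub>R fact k * exp (- r)) sums (exp (r * exp t) * exp (- r))"
    by (intro sums_mult2 exp_converges)
  moreover have "(r * exp t) ^ k /\<^sub>R fact k * exp (- r) = r ^ k / fact k * exp (- r) * exp (t * real k)" for k
    by (simp add: power_mult_distrib divide_inverse exp_of_nat2_mult)
  moreover have "exp (r * exp t) * exp (- r) = exp ((exp t - 1) * r)"
    by (simp add: exp_add[symmetric] algebra_simps)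
  ultimately have s: "(\<lambda>k. r ^ k / fact k * exp (- r) * exp (t * real k)) sums exp ((exp t - 1) * r)"
    by (simp only:)
  have "(\<integral>\<^sup>+x. ennreal (exp (t * enn2real x)) \<partial>poisson_ennreal (ennreal r))
      = (\<Sum>k. ennreal (r ^ k / fact k * exp (- r) * exp (t * real k)))"
    using r by (subst nn_integral_poisson_ennreal) (auto simp: ennreal_mult''[symmetric])
  also have "\<dots> = ennreal (exp ((exp t - 1) * r))"
    using s r by (intro suminf_ennreal_eq) auto
  finally show ?thesis .
qed

lemma poisson_ennreal_mean:
  assumes r: "r \<ge> 0"
  shows "integrable (poisson_ennreal (ennreal r)) enn2real" "(\<integral>x. enn2real x \<partial>poisson_ennreal (ennreal r)) = r"
proof -
  have "(\<lambda>k. (r ^ k /\<^sub>R fact k) * (r * exp (- r))) sums (exp r * (r * exp (- r)))"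
    by (intro sums_mult2 exp_converges)
  moreover have "(r ^ k /\<^sub>R fact k) * (r * exp (- r)) = r ^ Suc k / fact (Suc k) * exp (- r) * real (Suc k)" for k
    by (simp add: field_simps del: of_nat_Suc)
  moreover have "exp r * (r * exp (- r)) = r" by (simp add: exp_minus)
  ultimately have "(\<lambda>k. r ^ Suc k / fact (Suc k) * exp (- r) * real (Suc k)) sums r"
    by (simp only:)
  \<comment> \<open>The index shift can be undone because the term at \<open>k = 0\<close>
    vanishes.\<close>
  then have s: "(\<lambda>k. r ^ k / fact k * exp (- r) * real k) sums r"
    by (subst (asm) sums_Suc_iff) simp
  have "(\<integral>\<^sup>+x. ennreal (enn2real x) \<partial>poisson_ennreal (ennreal r)) = (\<Sum>k. ennreal (r ^ k / fact k * exp (- r) * real k))"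
    using r by (subst nn_integral_poisson_ennreal) (auto simp: ennreal_mult''[symmetric])
  also have "\<dots> = ennreal r"
    using s r by (intro suminf_ennreal_eq) auto
  finally have eq: "(\<integral>\<^sup>+x. ennreal (enn2real x) \<partial>poisson_ennreal (ennreal r)) = ennreal r" .
  show "integrable (poisson_ennreal (ennreal r)) enn2real"
    using eq by (intro integrableI_nonneg) auto
  show "(\<integral>x. enn2real x \<partial>poisson_ennreal (ennreal r)) = r"
    using eq r by (subst integral_eq_nn_integral) auto
qed

text \<open>
  The logarithm of the density of \<open>Poi(a)\<close> with respect to \<open>Poi(b)\<close>. For \<open>a = 0 < b\<close> the density is
  \<open>exp b\<close> at \<open>0\<close> and vanishes elsewhere; the constant \<open>b\<close> then suffices for the change of measure
  as an inequality. The case \<open>b \<in> {0, \<infinity>}\<close> is only used when \<open>a = b\<close>.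
\<close>

definition poisson_log_ratio :: "ennreal \<Rightarrow> ennreal \<Rightarrow> ennreal \<Rightarrow> real" where
  "poisson_log_ratio a b x =
     (if b = 0 \<or> b = \<infinity> then 0
      else if a = 0 then enn2real b
      else enn2real x * ln (enn2real a / enn2real b) + (enn2real b - enn2real a))"

lemma measurable_poisson_log_ratio [measurable]: "poisson_log_ratio a b \<in> borel_measurable borel"
  unfolding poisson_log_ratio_def by measurable

text \<open>If both rates are positive and finite, the weighted atoms of \<open>Poi(a)\<close> are
  exactly those of \<open>Poi(b)\<close>. If \<open>a = 0 < b\<close>, only the atom at
  \<open>0\<close> is matched, whence an inequality. In the degenerate cases the hypotheses force
  \<open>a = b\<close>.\<close>

lemma poisson_ennreal_change_measure:
  assumes [measurable]: "u \<in> borel_measurable borel" and ab: "b = 0 \<Longrightarrow> a = 0" "a = \<infinity> \<longleftrightarrow> b = \<infinity>"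
  shows "(\<integral>\<^sup>+x. ennreal (exp (- poisson_log_ratio a b x)) * u x \<partial>poisson_ennreal a) \<le> (\<integral>\<^sup>+x. u x \<partial>poisson_ennreal b)"
proof (cases "b = 0 \<or> b = \<infinity>")
  case True
  then have "a = b" using ab by auto
  with True show ?thesis by (simp add: poisson_log_ratio_def)
next
  case False
  then obtain r s where rs: "a = ennreal r" "b = ennreal s" "r \<ge> 0" "s > 0"
    using ab by (cases a; cases b) auto
  have "ennreal (r ^ k / fact k * exp (- r)) * (ennreal (exp (- poisson_log_ratio a b (of_nat k))) * u (of_nat k))
      \<le> ennreal (s ^ k / fact k * exp (- s)) * u (of_nat k)" for k
  proof -
    have "r ^ k / fact k * exp (- r) * exp (- poisson_log_ratio a b (of_nat k)) \<le> s ^ k / fact k * exp (- s)"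
    proof (cases "r = 0")
      case True
      then show ?thesis using rs by (cases k) (auto simp: poisson_log_ratio_def)
    next
      case False
      with rs have "exp (real k * ln (r / s)) = (r / s) ^ k" by (simp add: exp_of_nat_mult)
      with rs False have "exp (- poisson_log_ratio a b (of_nat k)) = (s / r) ^ k * exp (r - s)"
        by (simp add: poisson_log_ratio_def exp_add exp_diff exp_minus power_divide field_simps)
      then show ?thesis using rs False by (simp add: power_divide exp_diff exp_minus field_simps)
    qed
    then show ?thesis
      using rs by (simp add: mult.assoc[symmetric] ennreal_mult[symmetric] mult_right_mono ennreal_leI)
  qed
  then show ?thesis
    using rs by (simp add: nn_integral_poisson_ennreal suminf_le)
qed

text \<open>The mean is the divergence of \<open>Poi(r)\<close> from \<open>Poi(s)\<close>, which
  for \<open>r = 0\<close> equals \<open>s\<close>.\<close>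

lemma poisson_log_ratio_mean:
  assumes "a = ennreal r" "b = ennreal s" "r \<ge> 0" "s > 0"
  shows "integrable (poisson_ennreal a) (poisson_log_ratio a b)"
    "(\<integral>x. poisson_log_ratio a b x \<partial>poisson_ennreal a) = (if r = 0 then s else r * ln (r / s) + (s - r))"
proof -
  interpret prob_space "poisson_ennreal a" by (rule prob_space_poisson_ennreal)
  note m = poisson_ennreal_mean[OF \<open>r \<ge> 0\<close>, folded assms(1)]
  have eq: "poisson_log_ratio a b = (if r = 0 then (\<lambda>x. s) else (\<lambda>x. enn2real x * ln (r / s) + (s - r)))"
    using assms by (auto simp: poisson_log_ratio_def fun_eq_iff)
  show "integrable (poisson_ennreal a) (poisson_log_ratio a b)"
    using m by (simp add: eq)
  show "(\<integral>x. poisson_log_ratio a b x \<partial>poisson_ennreal a) = (if r = 0 then s else r * ln (r / s) + (s - r))"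
    using m prob_space[unfolded space_poisson_ennreal] by (simp add: eq)
qed

section \<open>Products of Poisson distributions\<close>

text \<open>Induction on the coordinates: Fubini's theorem separates coordinate \<open>i\<close>,
  the one-dimensional inequality replaces \<open>A i\<close> by \<open>B i\<close> with the other
  coordinates fixed, and the induction hypothesis is applied to the resulting inner integral. This
  is why \<open>\<phi>\<close> is generalized in the induction.\<close>

lemma nn_integral_PiM_change_measure:
  fixes A B :: "'i \<Rightarrow> 'a measure" and w :: "'i \<Rightarrow> 'a \<Rightarrow> real"
  assumes A: "\<And>i. prob_space (A i)" and B: "\<And>i. prob_space (B i)"
    and sA [measurable_cong]: "\<And>i. sets (A i) = sets N" and sB [measurable_cong]: "\<And>i. sets (B i) = sets N"
    and w [measurable]: "\<And>i. w i \<in> borel_measurable N"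
    and le: "\<And>i u. i \<in> I \<Longrightarrow> u \<in> borel_measurable N \<Longrightarrow>
      (\<integral>\<^sup>+x. ennreal (exp (- w i x)) * u x \<partial>A i) \<le> (\<integral>\<^sup>+x. u x \<partial>B i)"
    and "finite I" and "\<phi> \<in> borel_measurable (\<Pi>\<^sub>M i\<in>I. N)"
  shows "(\<integral>\<^sup>+x. ennreal (exp (- (\<Sum>i\<in>I. w i (x i)))) * \<phi> x \<partial>Pi\<^sub>M I A) \<le> (\<integral>\<^sup>+x. \<phi> x \<partial>Pi\<^sub>M I B)"
  using \<open>finite I\<close> \<open>\<phi> \<in> _\<close> le
proof (induction I arbitrary: \<phi> rule: finite_induct)
  case empty
  then show ?case by (simp add: PiM_empty)
next
  case (insert i I)
  interpret Bi: prob_space "B i" by (rule B)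
  interpret Ai: prob_space "A i" by (rule A)
  interpret A: product_prob_space A by (rule product_prob_spaceI) (rule A)
  interpret B: product_prob_space B by (rule product_prob_spaceI) (rule B)
  note [measurable] = insert.prems(1)
  have [measurable_cong]: "sets (Pi\<^sub>M I A) = sets (\<Pi>\<^sub>M i\<in>I. N)" "sets (Pi\<^sub>M I B) = sets (\<Pi>\<^sub>M i\<in>I. N)"
    "sets (Pi\<^sub>M (insert i I) A) = sets (\<Pi>\<^sub>M i\<in>insert i I. N)" "sets (Pi\<^sub>M (insert i I) B) = sets (\<Pi>\<^sub>M i\<in>insert i I. N)"
    by (auto intro!: sets_PiM_cong sA sB)
  have upd: "(\<lambda>y. \<phi> (x(i := y))) \<in> borel_measurable N" if "x \<in> space (\<Pi>\<^sub>M i\<in>I. N)" for x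
    by (rule measurable_compose[OF measurable_component_update insert.prems(1)]) (use that insert.hyps in auto)
  \<comment> \<open>This inner integral is the function to which the induction hypothesis is
    applied.\<close>
  have upd_int [measurable]: "(\<lambda>x. \<integral>\<^sup>+y. \<phi> (x(i := y)) \<partial>B i) \<in> borel_measurable (\<Pi>\<^sub>M i\<in>I. N)"
  proof (rule Bi.borel_measurable_nn_integral)
    have "(\<lambda>(x, y). x(i := y)) \<in> (\<Pi>\<^sub>M i\<in>I. N) \<Otimes>\<^sub>M B i \<rightarrow>\<^sub>M (\<Pi>\<^sub>M i\<in>insert i I. N)"
      using measurable_add_dim[of i I "\<lambda>_. N"] by (simp cong: measurable_cong_sets sets_pair_measure_cong add: sB)
    from measurable_compose[OF this insert.prems(1)]
    show "(\<lambda>(x, y). \<phi> (x(i := y))) \<in> borel_measurable ((\<Pi>\<^sub>M i\<in>I. N) \<Otimes>\<^sub>M B i)"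
      by (simp add: case_prod_beta')
  qed
  have "(\<integral>\<^sup>+x. ennreal (exp (- (\<Sum>j\<in>insert i I. w j (x j)))) * \<phi> x \<partial>Pi\<^sub>M (insert i I) A)
      = (\<integral>\<^sup>+x. (\<integral>\<^sup>+y. ennreal (exp (- (\<Sum>j\<in>insert i I. w j ((x(i := y)) j)))) * \<phi> (x(i := y)) \<partial>A i) \<partial>Pi\<^sub>M I A)"
    by (rule A.product_nn_integral_insert) (use insert.hyps in auto)
  also have "\<dots> = (\<integral>\<^sup>+x. ennreal (exp (- (\<Sum>j\<in>I. w j (x j)))) * (\<integral>\<^sup>+y. ennreal (exp (- w i y)) * \<phi> (x(i := y)) \<partial>A i) \<partial>Pi\<^sub>M I A)"
  proof (rule nn_integral_cong)
    fix x assume "x \<in> space (Pi\<^sub>M I A)"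
    then have x: "x \<in> space (\<Pi>\<^sub>M i\<in>I. N)" by (simp add: space_PiM sets_eq_imp_space_eq[OF sA])
    note [measurable] = upd[OF x]
    have "(\<Sum>j\<in>I. w j ((x(i := y)) j)) = (\<Sum>j\<in>I. w j (x j))" for y
      using insert.hyps by (intro sum.cong) auto
    then have "ennreal (exp (- (\<Sum>j\<in>insert i I. w j ((x(i := y)) j)))) * \<phi> (x(i := y))
        = ennreal (exp (- (\<Sum>j\<in>I. w j (x j)))) * (ennreal (exp (- w i y)) * \<phi> (x(i := y)))" for y
      using insert.hyps by (simp add: exp_diff exp_minus divide_inverse ennreal_mult mult_ac)
    then show "(\<integral>\<^sup>+y. ennreal (exp (- (\<Sum>j\<in>insert i I. w j ((x(i := y)) j)))) * \<phi> (x(i := y)) \<partial>A i)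
        = ennreal (exp (- (\<Sum>j\<in>I. w j (x j)))) * (\<integral>\<^sup>+y. ennreal (exp (- w i y)) * \<phi> (x(i := y)) \<partial>A i)"
      by (simp add: nn_integral_cmult)
  qed
  also have "\<dots> \<le> (\<integral>\<^sup>+x. ennreal (exp (- (\<Sum>j\<in>I. w j (x j)))) * (\<integral>\<^sup>+y. \<phi> (x(i := y)) \<partial>B i) \<partial>Pi\<^sub>M I A)"
    using upd by (intro nn_integral_mono mult_left_mono insert.prems(2)) (auto simp: space_PiM sets_eq_imp_space_eq[OF sA])
  also have "\<dots> \<le> (\<integral>\<^sup>+x. (\<integral>\<^sup>+y. \<phi> (x(i := y)) \<partial>B i) \<partial>Pi\<^sub>M I B)"
    by (rule insert.IH[OF upd_int]) (auto intro: insert.prems(2))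
  also have "\<dots> = (\<integral>\<^sup>+x. \<phi> x \<partial>Pi\<^sub>M (insert i I) B)"
    by (rule B.product_nn_integral_insert[symmetric]) (use insert.hyps in auto)
  finally show ?case .
qed

text \<open>
  Each claim comes from the integrated Young inequality for a suitable \<open>t\<close>: large \<open>t\<close>, \<open>t = 1\<close>,
  or \<open>t = \<bar>ln (a / b)\<bar>\<close>.
\<close>

lemma poisson_kl_finite:
  assumes f: "has_density nu lam f" and g: "has_density nu mu g" and D: "D \<in> sets nu"
    and k: "(\<integral>\<^sup>+x\<in>D. kl_term (f x) (g x) \<partial>nu) = ennreal k" "k \<ge> 0"
  defines "a \<equiv> emeasure lam D" and "b \<equiv> emeasure mu D"
  shows "b = 0 \<Longrightarrow> a = 0" "a = \<infinity> \<longleftrightarrow> b = \<infinity>"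
    "integrable (poisson_ennreal a) (poisson_log_ratio a b)"
    "(\<integral>x. poisson_log_ratio a b x \<partial>poisson_ennreal a) \<le> k"
proof -
  have Y1: "ennreal t * a \<le> ennreal k + ennreal (exp t - 1) * b"
    and Y2: "ennreal (1 - exp (- t)) * b \<le> ennreal k + ennreal t * a" if "t \<ge> 0" for t
    using kl_set_integral_ge[OF f g D that] by (simp_all add: k a_def b_def)
  have "b = \<infinity>" if "a = \<infinity>" using Y1[of 1] that by (cases b) (auto simp: ennreal_mult[symmetric] ennreal_plus[symmetric] top_unique simp del: ennreal_plus)
  moreover have "a = \<infinity>" if "b = \<infinity>" using Y2[of 1] that
    by (cases a) (auto simp: ennreal_mult_top ennreal_plus[symmetric] top_unique simp del: ennreal_plus)
  ultimately show inf: "a = \<infinity> \<longleftrightarrow> b = \<infinity>" by blast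
  show b0: "a = 0" if "b = 0"
  proof (rule ccontr)
    assume "a \<noteq> 0"
    with inf that obtain r where r: "a = ennreal r" "r > 0" by (cases a) (auto simp: less_le)
    \<comment> \<open>At this \<open>t\<close> and with \<open>b = 0\<close> the inequality would
      read \<open>k + 1 \<le> k\<close>.\<close>
    with Y1[of "(k + 1) / r"] that k(2) show False by (simp add: ennreal_mult[symmetric])
  qed
  interpret prob_space "poisson_ennreal a" by (rule prob_space_poisson_ennreal)
  have "integrable (poisson_ennreal a) (poisson_log_ratio a b) \<and> (\<integral>x. poisson_log_ratio a b x \<partial>poisson_ennreal a) \<le> k"
  proof (cases "b = 0 \<or> b = \<infinity>")
    case True
    then have "poisson_log_ratio a b = (\<lambda>_. 0)" by (auto simp: poisson_log_ratio_def)
    then show ?thesis using k by simp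
  next
    case False
    then obtain r s where rs: "a = ennreal r" "b = ennreal s" "r \<ge> 0" "s > 0"
      using inf by (cases a; cases b) (auto simp: less_le)
    have Y1': "t * r \<le> k + (exp t - 1) * s" and Y2': "(1 - exp (- t)) * s \<le> k + t * r" if "t \<ge> 0" for t
      using Y1[OF that] Y2[OF that] that rs k(2)
      by (simp_all add: ennreal_mult[symmetric] ennreal_plus[symmetric] del: ennreal_plus)
    have "(if r = 0 then s else r * ln (r / s) + (s - r)) \<le> k"
    proof (cases "r = 0")
      case True
      have "((\<lambda>t. (1 - exp (- t)) * s) \<longlongrightarrow> (1 - 0) * s) at_top"
        by (intro tendsto_intros filterlim_compose[OF exp_at_bot filterlim_uminus_at_bot_at_top])
      then have "s \<le> k"
        using Y2' True by (intro tendsto_upperbound[of "\<lambda>t. (1 - exp (- t)) * s" s at_top])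
          (auto intro!: eventually_mono[OF eventually_ge_at_top[of 0]])
      then show ?thesis using True by simp
    next
      case False
      \<comment> \<open>Young's inequality is sharp at \<open>ln (r / s)\<close>. The two bounds are
        stated for \<open>t \<ge> 0\<close>, so the sign of the logarithm decides which of them
        applies.\<close>
      show ?thesis
      proof (cases "ln (r / s) \<ge> 0")
        case True
        moreover have "(exp (ln (r / s)) - 1) * s = r - s" using False rs by (simp add: algebra_simps)
        ultimately show ?thesis using Y1'[of "ln (r / s)"] False by (simp add: mult.commute)
      next
        case *: False
        moreover have "(1 - exp (- (- ln (r / s)))) * s = s - r" using False rs by (simp add: algebra_simps)
        ultimately show ?thesis using Y2'[of "- ln (r / s)"] False by (simp add: mult.commute)
      qed
    qed
    then show ?thesis using poisson_log_ratio_mean[OF rs] by simp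
  qed
  then show "integrable (poisson_ennreal a) (poisson_log_ratio a b)"
    "(\<integral>x. poisson_log_ratio a b x \<partial>poisson_ennreal a) \<le> k" by auto
qed

text \<open>Let \<open>W\<close> be the sum of the logarithmic ratios of the coordinates.
  Integrating \<open>y \<le> exp y - 1\<close> at \<open>y = \<phi> - W\<close> under
  \<open>P\<close> gives the claim, because the change of measure bounds the integral of
  \<open>exp (\<phi> - W)\<close> by that of \<open>exp \<phi>\<close> under \<open>Q\<close>, and
  the mean of \<open>W\<close> is at most \<open>K\<close>.\<close>

lemma poisson_product_variational:
  fixes D :: "'i \<Rightarrow> 'a set" and \<phi> :: "('i \<Rightarrow> ennreal) \<Rightarrow> real"
  assumes f: "has_density nu lam f" and g: "has_density nu mu g"
    and I: "finite I" "\<And>i. i \<in> I \<Longrightarrow> D i \<in> sets nu" "disjoint_family_on D I"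
    and K: "(\<integral>\<^sup>+x. kl_term (f x) (g x) \<partial>nu) = ennreal K" "K \<ge> 0"
    and \<phi> [measurable]: "\<phi> \<in> borel_measurable (\<Pi>\<^sub>M i\<in>I. borel)" and bdd: "\<And>x. \<bar>\<phi> x\<bar> \<le> T"
  shows "(\<integral>x. \<phi> x \<partial>(\<Pi>\<^sub>M i\<in>I. poisson_ennreal (emeasure lam (D i))))
    - (\<integral>x. exp (\<phi> x) \<partial>(\<Pi>\<^sub>M i\<in>I. poisson_ennreal (emeasure mu (D i)))) + 1 \<le> K"
proof -
  define a b where "a = (\<lambda>i. emeasure lam (D i))" and "b = (\<lambda>i. emeasure mu (D i))"
  define P Q where "P = (\<Pi>\<^sub>M i\<in>I. poisson_ennreal (a i))" and "Q = (\<Pi>\<^sub>M i\<in>I. poisson_ennreal (b i))"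
  define w where "w = (\<lambda>i. poisson_log_ratio (a i) (b i))"
  define W where "W = (\<lambda>x. \<Sum>i\<in>I. w i (x i))"
  note [measurable] = has_densityD(1)[OF f] has_densityD(1)[OF g]
  interpret PP: product_prob_space "\<lambda>i. poisson_ennreal (a i)" I
    by (rule product_prob_spaceI) (rule prob_space_poisson_ennreal)
  interpret QQ: product_prob_space "\<lambda>i. poisson_ennreal (b i)" I
    by (rule product_prob_spaceI) (rule prob_space_poisson_ennreal)
  interpret P: prob_space P unfolding P_def by (rule prob_space_PiM) (rule prob_space_poisson_ennreal)
  interpret Q: prob_space Q unfolding Q_def by (rule prob_space_PiM) (rule prob_space_poisson_ennreal)
  have [measurable_cong]: "sets P = sets (\<Pi>\<^sub>M i\<in>I. borel)" "sets Q = sets (\<Pi>\<^sub>M i\<in>I. borel)"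
    by (auto simp: P_def Q_def intro!: sets_PiM_cong)
  have [measurable]: "w i \<in> borel_measurable borel" for i by (simp add: w_def)
  have [measurable]: "W \<in> borel_measurable (\<Pi>\<^sub>M i\<in>I. borel)" unfolding W_def by measurable
  define k where "k = (\<lambda>i. enn2real (\<integral>\<^sup>+x\<in>D i. kl_term (f x) (g x) \<partial>nu))"
  have k: "(\<integral>\<^sup>+x\<in>D i. kl_term (f x) (g x) \<partial>nu) = ennreal (k i)" "k i \<ge> 0" for i
  proof -
    have "(\<integral>\<^sup>+x\<in>D i. kl_term (f x) (g x) \<partial>nu) \<le> (\<integral>\<^sup>+x. kl_term (f x) (g x) \<partial>nu)"
      by (intro nn_integral_mono) (auto simp: indicator_def)
    also have "\<dots> < \<top>" using K by simp
    finally show "(\<integral>\<^sup>+x\<in>D i. kl_term (f x) (g x) \<partial>nu) = ennreal (k i)" "k i \<ge> 0" by (auto simp: k_def)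
  qed
  \<comment> \<open>The bounds \<open>k i\<close> are integrals of one nonnegative function over
    disjoint sets, so together they do not exceed \<open>K\<close>.\<close>
  have "ennreal (\<Sum>i\<in>I. k i) = (\<Sum>i\<in>I. \<integral>\<^sup>+x\<in>D i. kl_term (f x) (g x) \<partial>nu)"
    using k by (simp add: sum_ennreal)
  also have "\<dots> = (\<integral>\<^sup>+x. (\<Sum>i\<in>I. kl_term (f x) (g x) * indicator (D i) x) \<partial>nu)"
    using I(2) by (intro nn_integral_sum[symmetric]) auto
  also have "\<dots> = (\<integral>\<^sup>+x. kl_term (f x) (g x) * indicator (\<Union>i\<in>I. D i) x \<partial>nu)"
    using I by (simp add: sum_distrib_left[symmetric] indicator_UN_disjoint)
  also have "\<dots> \<le> (\<integral>\<^sup>+x. kl_term (f x) (g x) \<partial>nu)"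
    by (intro nn_integral_mono) (auto simp: indicator_def)
  finally have kK: "(\<Sum>i\<in>I. k i) \<le> K" using K by (simp add: ennreal_le_iff)
  note fin = poisson_kl_finite[OF f g I(2) k(1) k(2), folded a_def b_def]
  have wi: "integrable P (\<lambda>x. w i (x i))" "(\<integral>x. w i (x i) \<partial>P) \<le> k i" if "i \<in> I" for i
  proof -
    have d: "distr P (poisson_ennreal (a i)) (\<lambda>x. x i) = poisson_ennreal (a i)"
      unfolding P_def by (rule PP.PiM_component) fact
    have [measurable]: "(\<lambda>x. x i) \<in> P \<rightarrow>\<^sub>M poisson_ennreal (a i)"
      unfolding P_def by (rule measurable_component_singleton) fact
    have "integrable (distr P (poisson_ennreal (a i)) (\<lambda>x. x i)) (w i)"
      unfolding d using fin(3)[OF that] by (simp add: w_def a_def b_def)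
    then show "integrable P (\<lambda>x. w i (x i))" by (subst (asm) integrable_distr_eq) auto
    have "(\<integral>x. w i x \<partial>distr P (poisson_ennreal (a i)) (\<lambda>x. x i)) \<le> k i"
      unfolding d using fin(4)[OF that] by (simp add: w_def a_def b_def)
    then show "(\<integral>x. w i (x i) \<partial>P) \<le> k i" by (subst (asm) integral_distr) auto
  qed
  have intW: "integrable P W" unfolding W_def using wi by auto
  have "(\<integral>x. W x \<partial>P) = (\<Sum>i\<in>I. \<integral>x. w i (x i) \<partial>P)" unfolding W_def using wi by auto
  also have "\<dots> \<le> (\<Sum>i\<in>I. k i)" using wi by (intro sum_mono)
  finally have EW: "(\<integral>x. W x \<partial>P) \<le> K" using kK by simp
  have int\<phi>: "integrable P \<phi>" using bdd by (intro P.integrable_const_bound[of _ T]) auto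
  have inte: "integrable Q (\<lambda>x. exp (\<phi> x))" using bdd
    by (intro Q.integrable_const_bound[of _ "exp T"]) (auto intro: abs_le_D1)
  have "(\<integral>\<^sup>+x. ennreal (exp (\<phi> x - W x)) \<partial>P) = (\<integral>\<^sup>+x. ennreal (exp (- W x)) * ennreal (exp (\<phi> x)) \<partial>P)"
    by (simp add: ennreal_mult[symmetric] exp_add[symmetric] exp_diff exp_minus field_simps)
  also have "\<dots> \<le> (\<integral>\<^sup>+x. ennreal (exp (\<phi> x)) \<partial>Q)"
    unfolding P_def Q_def W_def
  proof (rule nn_integral_PiM_change_measure[where N = borel])
    fix i and u :: "ennreal \<Rightarrow> ennreal" assume "i \<in> I" "u \<in> borel_measurable borel"
    then show "(\<integral>\<^sup>+x. ennreal (exp (- w i x)) * u x \<partial>poisson_ennreal (a i)) \<le> (\<integral>\<^sup>+x. u x \<partial>poisson_ennreal (b i))"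
      unfolding w_def using fin(1,2)[OF \<open>i \<in> I\<close>] 
      by (intro poisson_ennreal_change_measure) (auto simp: a_def b_def)
  qed (use I in \<open>auto intro: prob_space_poisson_ennreal\<close>)
  also have "\<dots> = ennreal (\<integral>x. exp (\<phi> x) \<partial>Q)"
    using inte by (intro nn_integral_eq_integral) auto
  finally have le: "(\<integral>\<^sup>+x. ennreal (exp (\<phi> x - W x)) \<partial>P) \<le> ennreal (\<integral>x. exp (\<phi> x) \<partial>Q)" .
  then have int2: "integrable P (\<lambda>x. exp (\<phi> x - W x))"
    by (intro integrableI_nonneg) (auto intro: le_less_trans)
  have "(\<integral>x. exp (\<phi> x - W x) \<partial>P) \<le> (\<integral>x. exp (\<phi> x) \<partial>Q)"
    using le int2 by (simp add: nn_integral_eq_integral)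
  moreover have "(\<integral>x. \<phi> x - W x \<partial>P) \<le> (\<integral>x. exp (\<phi> x - W x) - 1 \<partial>P)"
    using int\<phi> intW int2 by (intro integral_mono) (auto simp: le_diff_eq add.commute)
  ultimately have "(\<integral>x. \<phi> x \<partial>P) - (\<integral>x. exp (\<phi> x) \<partial>Q) + 1 \<le> K"
    using EW int\<phi> intW int2 P.prob_space by simp
  then show ?thesis by (simp add: P_def Q_def a_def b_def)
qed

section \<open>Cylinder events\<close>

text \<open>Cylinders use pairwise disjoint sets, so that Poisson processes make the coordinates independent.\<close>

definition cylinder_over :: "'a measure \<Rightarrow> nat \<Rightarrow> (nat \<Rightarrow> 'a set) \<Rightarrow> (nat \<Rightarrow> ennreal) set \<Rightarrow> 'a measure set" where
  "cylinder_over M n B E = {\<eta> \<in> point_patterns M. (\<lambda>i\<in>{1..n}. emeasure \<eta> (B i)) \<in> E}"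

definition cylinder :: "'a measure \<Rightarrow> 'a measure set \<Rightarrow> bool" where
  "cylinder M C \<longleftrightarrow> (\<exists>n\<ge>1. \<exists>B E. (\<forall>i\<in>{1..n}. B i \<in> sets M) \<and> disjoint_family_on B {1..n} \<and>
     E \<in> sets (\<Pi>\<^sub>M i\<in>{1..n}. borel) \<and> C = cylinder_over M n B E)"

lemma sets_point_patterns: "\<eta> \<in> point_patterns M \<Longrightarrow> sets \<eta> = sets M"
  by (simp add: point_patterns_def)

lemma measurable_counts:
  assumes "\<And>i. i \<in> I \<Longrightarrow> B i \<in> sets M"
  shows "(\<lambda>\<eta>. \<lambda>i\<in>I. emeasure \<eta> (B i)) \<in> point_pattern_algebra M \<rightarrow>\<^sub>M (\<Pi>\<^sub>M i\<in>I. borel)"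
  by (intro measurable_restrict measurable_emeasure_point_pattern_algebra assms)

lemma cylinder_measurable: "cylinder M C \<Longrightarrow> C \<in> sets (point_pattern_algebra M)"
  using measurable_sets[OF measurable_counts]
  by (fastforce simp: cylinder_def cylinder_over_def space_point_pattern_algebra vimage_def Int_def conj_commute)

text \<open>\<open>h\<close> enumerates the subsets of \<open>\<B>\<close>, and \<open>D i\<close>
  consists of the points that lie in exactly those members of \<open>\<B>\<close> which belong to
  \<open>h i\<close>. Some \<open>D i\<close> may be empty. As \<open>Pow \<B>\<close> contains the
  empty set, \<open>n \<ge> 1\<close> holds even without any sets.\<close>

lemma finite_sets_disjoint_atoms:
  assumes "finite \<B>" "\<B> \<subseteq> sets M"
  obtains n :: nat and D and h :: "nat \<Rightarrow> 'a set set" where "n \<ge> 1"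
    "\<And>i. i \<in> {1..n} \<Longrightarrow> D i \<in> sets M" "disjoint_family_on D {1..n}"
    "\<And>b. b \<in> \<B> \<Longrightarrow> b = (\<Union>i\<in>{i\<in>{1..n}. b \<in> h i}. D i)"
proof -
  define n where "n = card (Pow \<B>)"
  have "finite (Pow \<B>)" using assms by simp
  then obtain h where h: "bij_betw h {1..n} (Pow \<B>)"
    using ex_bij_betw_nat_finite_1 n_def by blast
  define D where "D = (\<lambda>i. {x \<in> space M. {b \<in> \<B>. x \<in> b} = h i})"
  show thesis
  proof (rule that[of n D h])
    show "n \<ge> 1" using assms by (simp add: n_def card_Pow)
    show "D i \<in> sets M" if "i \<in> {1..n}" for i
    proof -
      have "h i \<subseteq> \<B>" using h that by (auto simp: bij_betw_def)
      then have "D i = {x \<in> space M. \<forall>b\<in>\<B>. x \<in> b \<longleftrightarrow> b \<in> h i}" by (auto simp: D_def)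
      also have "\<dots> \<in> sets M"
      proof (rule sets.sets_Collect_finite_All)
        fix b assume "b \<in> \<B>"
        then have "b \<in> sets M" using assms by blast
        moreover have "{x \<in> space M. x \<in> b} = b" using sets.sets_into_space[OF \<open>b \<in> sets M\<close>] by blast
        ultimately show "{x \<in> space M. x \<in> b \<longleftrightarrow> b \<in> h i} \<in> sets M"
          by (cases "b \<in> h i") (auto intro: sets.sets_Collect_neg)
      qed fact
      finally show ?thesis .
    qed
    show "disjoint_family_on D {1..n}"
      unfolding disjoint_family_on_def
    proof (intro ballI impI)
      fix i j assume "i \<in> {1..n}" "j \<in> {1..n}" "i \<noteq> j"
      then have "h i \<noteq> h j" using h by (metis bij_betw_def inj_onD)
      then show "D i \<inter> D j = {}" unfolding D_def by blast
    qed
    show "b = (\<Union>i\<in>{i\<in>{1..n}. b \<in> h i}. D i)" if b: "b \<in> \<B>" for b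
    proof (intro equalityI subsetI)
      fix x assume x: "x \<in> b"
      have "{b \<in> \<B>. x \<in> b} \<in> h ` {1..n}" using h by (auto simp: bij_betw_def)
      then obtain i where "i \<in> {1..n}" "h i = {b \<in> \<B>. x \<in> b}" by auto
      moreover have "x \<in> space M" using x b assms sets.sets_into_space by blast
      ultimately show "x \<in> (\<Union>i\<in>{i\<in>{1..n}. b \<in> h i}. D i)" using x b by (auto simp: D_def)
    qed (auto simp: D_def)
  qed
qed

text \<open>All the sets involved are cut into common atoms; by additivity the original counts are
  sums of atom counts. Once finitely many cylinders share the sets \<open>D\<close>, Boolean
  operations on them become operations on their bases \<open>E j\<close>.\<close>

lemma cylinder_common:
  fixes C :: "'j \<Rightarrow> 'a measure set"
  assumes "finite J" and C: "\<And>j. j \<in> J \<Longrightarrow> cylinder M (C j)"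
  obtains n D E where "n \<ge> 1" "\<And>i. i \<in> {1..n} \<Longrightarrow> D i \<in> sets M" "disjoint_family_on D {1..n}"
    "\<And>j. j \<in> J \<Longrightarrow> E j \<in> sets (\<Pi>\<^sub>M i\<in>{1..n}. borel)" "\<And>j. j \<in> J \<Longrightarrow> C j = cylinder_over M n D (E j)"
proof -
  have "\<forall>j\<in>J. \<exists>n B E. (\<forall>i\<in>{1..n}. B i \<in> sets M) \<and> E \<in> sets (\<Pi>\<^sub>M i\<in>{1..n}. borel) \<and> C j = cylinder_over M n B E"
    using C unfolding cylinder_def by metis
  then obtain m B E where B: "\<And>j i. j \<in> J \<Longrightarrow> i \<in> {1..m j} \<Longrightarrow> B j i \<in> sets M"
    and E: "\<And>j. j \<in> J \<Longrightarrow> E j \<in> sets (\<Pi>\<^sub>M i\<in>{1..m j}. borel)"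
    and CE: "\<And>j. j \<in> J \<Longrightarrow> C j = cylinder_over M (m j) (B j) (E j)"
    by metis
  define \<B> where "\<B> = (\<Union>j\<in>J. B j ` {1..m j})"
  have fin: "finite \<B>" "\<B> \<subseteq> sets M" using \<open>finite J\<close> B by (auto simp: \<B>_def)
  obtain n :: nat and D h where n: "n \<ge> 1" "\<And>i. i \<in> {1..n} \<Longrightarrow> D i \<in> sets M" "disjoint_family_on D {1..n}"
    and b: "\<And>b. b \<in> \<B> \<Longrightarrow> b = (\<Union>i\<in>{i\<in>{1..n}. b \<in> h i}. D i)"
    by (fact finite_sets_disjoint_atoms[OF fin])
  \<comment> \<open>\<open>T j\<close> recovers the counts of the sets \<open>B j i\<close> from the
    counts of the atoms, so the new base is its preimage of the old one.\<close>
  define T where "T = (\<lambda>j (x :: nat \<Rightarrow> ennreal). \<lambda>i\<in>{1..m j}. \<Sum>k\<in>{k\<in>{1..n}. B j i \<in> h k}. x k)"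
  define E' where "E' = (\<lambda>j. T j -` E j \<inter> space (\<Pi>\<^sub>M i\<in>{1..n}. borel))"
  have T: "T j \<in> (\<Pi>\<^sub>M i\<in>{1..n}. borel) \<rightarrow>\<^sub>M (\<Pi>\<^sub>M i\<in>{1..m j}. borel)" for j
    unfolding T_def
    by (intro measurable_restrict borel_measurable_sum measurable_component_singleton) auto
  show thesis
  proof (rule that[of n D E'])
    show "E' j \<in> sets (\<Pi>\<^sub>M i\<in>{1..n}. borel)" if "j \<in> J" for j
      unfolding E'_def using T E[OF that] by (rule measurable_sets)
    show "C j = cylinder_over M n D (E' j)" if j: "j \<in> J" for j
    proof -
      have "T j (\<lambda>i\<in>{1..n}. emeasure \<eta> (D i)) = (\<lambda>i\<in>{1..m j}. emeasure \<eta> (B j i))"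
        if \<eta>: "\<eta> \<in> point_patterns M" for \<eta>
        unfolding T_def
      proof (rule restrict_ext)
        fix i assume i: "i \<in> {1..m j}"
        let ?I = "{k\<in>{1..n}. B j i \<in> h k}"
        have "B j i \<in> \<B>" using i j unfolding \<B>_def by blast
        have "(\<Sum>k\<in>?I. (\<lambda>i\<in>{1..n}. emeasure \<eta> (D i)) k) = (\<Sum>k\<in>?I. emeasure \<eta> (D k))"
          by (intro sum.cong) auto
        also have "\<dots> = emeasure \<eta> (\<Union>k\<in>?I. D k)"
          using n sets_point_patterns[OF \<eta>]
          by (intro sum_emeasure) (auto simp: disjoint_family_on_def)
        also have "\<dots> = emeasure \<eta> (B j i)" using b[OF \<open>B j i \<in> \<B>\<close>] by simp
        finally show "(\<Sum>k\<in>?I. (\<lambda>i\<in>{1..n}. emeasure \<eta> (D i)) k) = emeasure \<eta> (B j i)" .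
      qed
      then show ?thesis unfolding CE[OF j] cylinder_over_def E'_def
        by (auto simp: space_PiM)
    qed
  qed (use n in auto)
qed

lemma cylinder_over_cylinder:
  assumes "n \<ge> 1" "\<And>i. i \<in> {1..n} \<Longrightarrow> D i \<in> sets M" "disjoint_family_on D {1..n}" "E \<in> sets (\<Pi>\<^sub>M i\<in>{1..n}. borel)"
  shows "cylinder M (cylinder_over M n D E)"
  using assms unfolding cylinder_def by blast

section \<open>Closure properties of cylinders and approximation of events\<close>

lemma cylinder_Diff:
  assumes "cylinder M C" "cylinder M C'"
  shows "cylinder M (C - C')"
proof -
  obtain n D E where *: "n \<ge> 1" "\<And>i. i \<in> {1..n} \<Longrightarrow> D i \<in> sets M" "disjoint_family_on D {1..n}"
    "\<And>j. j \<in> (UNIV::bool set) \<Longrightarrow> E j \<in> sets (\<Pi>\<^sub>M i\<in>{1..n}. borel)"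
    "\<And>j. j \<in> UNIV \<Longrightarrow> (if j then C else C') = cylinder_over M n D (E j)"
    by (rule cylinder_common[of UNIV M "\<lambda>j. if j then C else C'"]) (use assms in auto)
  have "C - C' = cylinder_over M n D (E True - E False)"
    using *(5)[of True] *(5)[of False] by (auto simp: cylinder_over_def)
  then show ?thesis using cylinder_over_cylinder[OF *(1-3), of "E True - E False"] *(4) by auto
qed

lemma cylinder_UN:
  assumes "finite J" "\<And>j. j \<in> J \<Longrightarrow> cylinder M (C j)"
  shows "cylinder M (\<Union>j\<in>J. C j)"
proof -
  obtain n D E where *: "n \<ge> 1" "\<And>i. i \<in> {1..n} \<Longrightarrow> D i \<in> sets M" "disjoint_family_on D {1..n}"
    "\<And>j. j \<in> J \<Longrightarrow> E j \<in> sets (\<Pi>\<^sub>M i\<in>{1..n}. borel)"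
    "\<And>j. j \<in> J \<Longrightarrow> C j = cylinder_over M n D (E j)"
    by (rule cylinder_common[OF assms]) auto
  have "(\<Union>j\<in>J. C j) = cylinder_over M n D (\<Union>j\<in>J. E j)"
    using *(5) by (auto simp: cylinder_over_def)
  then show ?thesis
    using cylinder_over_cylinder[OF *(1-3) sets.finite_UN[OF \<open>finite J\<close> *(4)]] by simp
qed

lemma cylinder_vimage:
  assumes "B \<in> sets M" "E \<in> sets borel"
  shows "cylinder M ((\<lambda>\<eta>. emeasure \<eta> B) -` E \<inter> point_patterns M)"
proof -
  have "(\<lambda>\<eta>. emeasure \<eta> B) -` E \<inter> point_patterns M
      = cylinder_over M 1 (\<lambda>_. B) ((\<lambda>x. x 1) -` E \<inter> space (\<Pi>\<^sub>M i\<in>{1..1::nat}. (borel :: ennreal measure)))"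
    by (auto simp: cylinder_over_def space_PiM)
  moreover have "(\<lambda>x. x 1) -` E \<inter> space (\<Pi>\<^sub>M i\<in>{1..1::nat}. (borel :: ennreal measure)) \<in> sets (\<Pi>\<^sub>M i\<in>{1..1}. borel)"
    by (rule measurable_sets[OF measurable_component_singleton]) (use assms in auto)
  ultimately show ?thesis
    using assms by (auto intro!: cylinder_over_cylinder simp: disjoint_family_on_def)
qed

lemma cylinder_space: "cylinder M (point_patterns M)"
  using cylinder_vimage[of "{}" M UNIV] by simp

text \<open>Writing the supremum of sigma-algebras as one generated sigma-algebra opens the way to
  induction over \<open>sigma_sets\<close>.\<close>

lemma sets_point_pattern_algebra:
  "sets (point_pattern_algebra M) = sigma_sets (point_patterns M)
     (\<Union>B\<in>sets M. {(\<lambda>\<eta>. emeasure \<eta> B) -` E \<inter> point_patterns M | E. E \<in> sets borel})"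
  unfolding point_pattern_algebra_def
  by (subst sets_Sup_eq[where X = "point_patterns M"])
    (auto simp: sets_vimage_algebra2)

text \<open>The approximable events contain the generators and are closed under complements, which
  leave symmetric differences unchanged. For a countable union, a finite part is enough by
  continuity of the finite measure, and finite unions of cylinders are cylinders.\<close>

lemma approximation_by_cylinders:
  assumes "finite_measure R" and sets: "sets R = sets (point_pattern_algebra M)"
    and A: "A \<in> sets R" and "\<epsilon> > 0"
  shows "\<exists>C. cylinder M C \<and> measure R ((A - C) \<union> (C - A)) < \<epsilon>"
proof -
  interpret finite_measure R by fact
  have cm [measurable]: "C \<in> sets R" if "cylinder M C" for C
    using cylinder_measurable[OF that] sets by simp
  have sp: "space R = point_patterns M"
    using sets_eq_imp_space_eq[OF sets] by (simp add: space_point_pattern_algebra)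
  let ?G = "\<Union>B\<in>sets M. {(\<lambda>\<eta>. emeasure \<eta> B) -` E \<inter> point_patterns M | E. E \<in> sets borel}"
  have G: "sets R = sigma_sets (point_patterns M) ?G"
    by (simp add: sets sets_point_pattern_algebra)
  from A[unfolded G] \<open>\<epsilon> > 0\<close> show ?thesis
  proof (induction arbitrary: \<epsilon>)
    case (Basic a)
    then have "cylinder M a" by (auto intro: cylinder_vimage)
    then show ?case using Basic by (intro exI[of _ a]) auto
  next
    case Empty
    then show ?case using cylinder_Diff[OF cylinder_space cylinder_space, of M]
      by (intro exI[of _ "{}"]) auto
  next
    case (Compl a)
    from Compl.IH[OF Compl.prems] obtain C where C: "cylinder M C" "measure R ((a - C) \<union> (C - a)) < \<epsilon>" by blast
    have "a \<subseteq> point_patterns M" "C \<subseteq> point_patterns M"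
      using Compl.hyps G sets.sets_into_space[of _ R] cm[OF C(1)] sp by auto
    then have "(point_patterns M - a - (point_patterns M - C)) \<union> (point_patterns M - C - (point_patterns M - a)) = (a - C) \<union> (C - a)"
      by auto
    then show ?case using C cylinder_Diff[OF cylinder_space C(1)] by (intro exI[of _ "point_patterns M - C"]) auto
  next
    case (Union a)
    have am [measurable]: "a i \<in> sets R" for i using Union.hyps G by simp
    have "(\<lambda>N. measure R (\<Union>i<N. a i)) \<longlonglongrightarrow> measure R (\<Union>N. \<Union>i<N. a i)"
      by (intro finite_Lim_measure_incseq) (auto simp: incseq_def intro: less_le_trans)
    also have "(\<Union>N. \<Union>i<N. a i) = (\<Union>i. a i)" by auto
    finally have "\<forall>\<^sub>F N in sequentially. measure R (\<Union>i. a i) - \<epsilon> / 2 < measure R (\<Union>i<N. a i)"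
      using Union.prems by (intro order_tendstoD(1)) auto
    then obtain N where N: "measure R (\<Union>i. a i) - \<epsilon> / 2 < measure R (\<Union>i<N. a i)"
      by (auto simp: eventually_sequentially)
    \<comment> \<open>\<open>N\<close> approximations with this error contribute at most
      \<open>\<epsilon> / 2\<close>, the other half being lost in the truncation; the summand
      \<open>1\<close> keeps the quotient defined for \<open>N = 0\<close>.\<close>
    have "\<epsilon> / (2 * (real N + 1)) > 0" using Union.prems by simp
    from Union.IH[OF this] obtain C where C: "\<And>i. cylinder M (C i)"
      "\<And>i. measure R ((a i - C i) \<union> (C i - a i)) < \<epsilon> / (2 * (real N + 1))" by metis
    note [measurable] = cm[OF C(1)]
    let ?C = "\<Union>i\<in>{..<N}. C i" and ?S = "\<lambda>i. (a i - C i) \<union> (C i - a i)"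
    have "measure R (((\<Union>i. a i) - ?C) \<union> (?C - (\<Union>i. a i)))
        \<le> measure R (((\<Union>i. a i) - (\<Union>i<N. a i)) \<union> (\<Union>i\<in>{..<N}. ?S i))"
      by (rule finite_measure_mono) auto
    also have "\<dots> \<le> measure R ((\<Union>i. a i) - (\<Union>i<N. a i)) + measure R (\<Union>i\<in>{..<N}. ?S i)"
      by (rule measure_Un_le) auto
    also have "measure R ((\<Union>i. a i) - (\<Union>i<N. a i)) = measure R (\<Union>i. a i) - measure R (\<Union>i<N. a i)"
      by (rule finite_measure_Diff) auto
    also have "measure R (\<Union>i\<in>{..<N}. ?S i) \<le> (\<Sum>i<N. measure R (?S i))"
      by (rule measure_UNION_le) auto
    also have "\<dots> \<le> (\<Sum>i<N. \<epsilon> / (2 * (real N + 1)))"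
      using C(2) by (intro sum_mono less_imp_le)
    also have "\<dots> \<le> \<epsilon> / 2" using Union.prems by (simp add: field_simps)
    finally have "measure R (((\<Union>i. a i) - ?C) \<union> (?C - (\<Union>i. a i))) < \<epsilon>"
      using N by simp
    moreover have "cylinder M ?C" using C(1) by (intro cylinder_UN) auto
    ultimately show ?case by blast
  qed
qed

section \<open>Divergence of Poisson point processes\<close>

lemma poisson_pp_distD:
  fixes n :: nat
  assumes "poisson_pp_dist lam P"
  shows "prob_space P" "sets P = sets (point_pattern_algebra lam)" "space P = point_patterns lam"
    "B \<in> sets lam \<Longrightarrow> distr P borel (\<lambda>\<eta>. emeasure \<eta> B) = poisson_ennreal (emeasure lam B)"
    "n \<ge> 1 \<Longrightarrow> (\<And>i. i \<in> {1..n} \<Longrightarrow> D i \<in> sets lam) \<Longrightarrow> disjoint_family_on D {1..n} \<Longrightarrow>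
      prob_space.indep_vars P (\<lambda>_. borel) (\<lambda>i \<eta>. emeasure \<eta> (D i)) {1..n}"
proof -
  show "prob_space P" "sets P = sets (point_pattern_algebra lam)" "space P = point_patterns lam"
    using assms by (auto simp: poisson_pp_dist_def space_point_pattern_algebra)
  show "distr P borel (\<lambda>\<eta>. emeasure \<eta> B) = poisson_ennreal (emeasure lam B)" if "B \<in> sets lam"
    using assms that by (simp add: poisson_pp_dist_def)
  have *: "\<forall>n\<ge>1. \<forall>B :: nat \<Rightarrow> 'a set. (\<forall>i\<in>{1..n}. B i \<in> sets lam) \<and> disjoint_family_on B {1..n} \<longrightarrow>
      prob_space.indep_vars P (\<lambda>_. borel) (\<lambda>i \<eta>. emeasure \<eta> (B i)) {1..n}"
    using assms unfolding poisson_pp_dist_def by (elim conjE)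
  show "prob_space.indep_vars P (\<lambda>_. borel) (\<lambda>i \<eta>. emeasure \<eta> (D i)) {1..n}"
    if "n \<ge> 1" "\<And>i. i \<in> {1..n} \<Longrightarrow> D i \<in> sets lam" "disjoint_family_on D {1..n}"
    using that by (intro *[THEN spec, THEN mp, THEN spec, THEN mp] conjI ballI)
qed

lemma measurable_emeasure_poisson_pp:
  assumes "poisson_pp_dist lam P" "B \<in> sets lam"
  shows "(\<lambda>\<eta>. emeasure \<eta> B) \<in> borel_measurable P"
  using measurable_emeasure_point_pattern_algebra[OF assms(2)] poisson_pp_distD(2)[OF assms(1)]
  by (simp cong: measurable_cong_sets)

text \<open>Independence over disjoint sets makes the joint law of the counts the product of its
  marginals; the disjointness in \<open>cylinder\<close> is there for this.\<close>

lemma poisson_pp_distr_counts: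
  fixes n :: nat
  assumes P: "poisson_pp_dist lam P" and "n \<ge> 1"
    and D: "\<And>i. i \<in> {1..n} \<Longrightarrow> D i \<in> sets lam" "disjoint_family_on D {1..n}"
  shows "distr P (\<Pi>\<^sub>M i\<in>{1..n}. borel) (\<lambda>\<eta>. \<lambda>i\<in>{1..n}. emeasure \<eta> (D i))
    = (\<Pi>\<^sub>M i\<in>{1..n}. poisson_ennreal (emeasure lam (D i)))"
proof -
  interpret prob_space P using P by (rule poisson_pp_distD)
  have ne: "{1..n} \<noteq> {}" using \<open>n \<ge> 1\<close> by simp
  have "distr P (\<Pi>\<^sub>M i\<in>{1..n}. borel) (\<lambda>\<eta>. \<lambda>i\<in>{1..n}. emeasure \<eta> (D i))
      = (\<Pi>\<^sub>M i\<in>{1..n}. distr P borel (\<lambda>\<eta>. emeasure \<eta> (D i)))"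
    using poisson_pp_distD(5)[OF P \<open>n \<ge> 1\<close> D] measurable_emeasure_poisson_pp[OF P D(1)]
    by (subst indep_vars_iff_distr_eq_PiM'[OF ne, symmetric]) auto
  also have "\<dots> = (\<Pi>\<^sub>M i\<in>{1..n}. poisson_ennreal (emeasure lam (D i)))"
    using poisson_pp_distD(4)[OF P D(1)] by (intro PiM_cong) auto
  finally show ?thesis .
qed

section \<open>Lower bound for the divergence of the laws\<close>

lemma poisson_pp_linear_statistic:
  fixes t :: "nat \<Rightarrow> real"
  assumes P: "poisson_pp_dist lam P"
    and A: "\<And>i. i \<le> n \<Longrightarrow> A i \<in> sets lam" "disjoint_family_on A {..n}"
    and fin: "\<And>i. i \<le> n \<Longrightarrow> emeasure lam (A i) < \<infinity>"
  defines "X \<equiv> (\<lambda>\<eta>. \<Sum>i\<le>n. t i * enn2real (emeasure \<eta> (A i)))"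
  shows "X \<in> borel_measurable P" "integrable P X" "(\<integral>\<eta>. X \<eta> \<partial>P) = (\<Sum>i\<le>n. t i * measure lam (A i))"
    "integrable P (\<lambda>\<eta>. exp (X \<eta>))" "(\<integral>\<eta>. exp (X \<eta>) \<partial>P) = exp (\<Sum>i\<le>n. (exp (t i) - 1) * measure lam (A i))"
proof -
  interpret prob_space P using P by (rule poisson_pp_distD)
  have cm [measurable]: "(\<lambda>\<eta>. emeasure \<eta> (A i)) \<in> borel_measurable P" if "i \<le> n" for i
    using measurable_emeasure_poisson_pp[OF P A(1)[OF that]] .
  have lam: "emeasure lam (A i) = ennreal (measure lam (A i))" if "i \<le> n" for i
    using fin[OF that] by (simp add: emeasure_eq_ennreal_measure less_top)
  have d: "distr P borel (\<lambda>\<eta>. emeasure \<eta> (A i)) = poisson_ennreal (ennreal (measure lam (A i)))" if "i \<le> n" for i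
    using poisson_pp_distD(4)[OF P A(1)[OF that]] lam[OF that] by simp
  show Xm [measurable]: "X \<in> borel_measurable P"
    unfolding X_def by (intro borel_measurable_sum borel_measurable_times borel_measurable_const
      measurable_compose[OF cm]) auto
  have int: "integrable P (\<lambda>\<eta>. enn2real (emeasure \<eta> (A i)))"
    "(\<integral>\<eta>. enn2real (emeasure \<eta> (A i)) \<partial>P) = measure lam (A i)" if "i \<le> n" for i
  proof -
    have "integrable (distr P borel (\<lambda>\<eta>. emeasure \<eta> (A i))) enn2real"
      "(\<integral>x. enn2real x \<partial>distr P borel (\<lambda>\<eta>. emeasure \<eta> (A i))) = measure lam (A i)"
      using poisson_ennreal_mean[of "measure lam (A i)"] by (simp_all add: d[OF that])
    then show "integrable P (\<lambda>\<eta>. enn2real (emeasure \<eta> (A i)))"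
      "(\<integral>\<eta>. enn2real (emeasure \<eta> (A i)) \<partial>P) = measure lam (A i)"
      using cm[OF that] by (simp_all add: integrable_distr_eq integral_distr)
  qed
  show "integrable P X" unfolding X_def using int(1) by auto
  show "(\<integral>\<eta>. X \<eta> \<partial>P) = (\<Sum>i\<le>n. t i * measure lam (A i))"
    unfolding X_def using int by (subst Bochner_Integration.integral_sum) auto
  have ne: "(\<integral>\<^sup>+\<eta>. ennreal (exp (t i * enn2real (emeasure \<eta> (A i)))) \<partial>P) = ennreal (exp ((exp (t i) - 1) * measure lam (A i)))"
    if "i \<le> n" for i
    using poisson_ennreal_exp[of "measure lam (A i)" "t i"] cm[OF that]
    by (simp add: d[OF that, symmetric] nn_integral_distr)
  \<comment> \<open>Independence is available for families indexed by \<open>{1..n}\<close>, whereas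
    \<open>A\<close> is indexed from \<open>0\<close>.\<close>
  define A' where "A' = (\<lambda>i. A (i - 1))"
  have ind: "indep_vars (\<lambda>_. borel) (\<lambda>i \<eta>. emeasure \<eta> (A' i)) {1..Suc n}"
  proof (rule poisson_pp_distD(5)[OF P])
    show "A' i \<in> sets lam" if "i \<in> {1..Suc n}" for i
      using A(1)[of "i - 1"] that by (auto simp: A'_def)
    show "disjoint_family_on A' {1..Suc n}"
      unfolding disjoint_family_on_def
    proof (intro ballI impI)
      fix i j assume "i \<in> {1..Suc n}" "j \<in> {1..Suc n}" "i \<noteq> j"
      then have "i - 1 \<in> {..n}" "j - 1 \<in> {..n}" "i - 1 \<noteq> j - 1" by auto
      then show "A' i \<inter> A' j = {}" using A(2) unfolding A'_def disjoint_family_on_def by blast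
    qed
  qed simp
  \<comment> \<open>The factors are taken in \<open>ennreal\<close>, where the product formula holds
    without prior integrability; integrability of \<open>exp X\<close> then follows from the finite
    value.\<close>
  have ind': "indep_vars (\<lambda>_. borel) (\<lambda>i \<eta>. ennreal (exp (t (i - 1) * enn2real (emeasure \<eta> (A' i))))) {1..Suc n}"
    by (rule indep_vars_compose2[OF ind]) measurable
  have reindex: "(\<Prod>i\<le>n. h i) = (\<Prod>i\<in>{1..Suc n}. h (i - 1))" for h :: "nat \<Rightarrow> ennreal"
    by (rule prod.reindex_bij_witness[where i = "\<lambda>i. i - 1" and j = Suc]) auto
  have "ennreal (exp (X \<eta>)) = (\<Prod>i\<in>{1..Suc n}. ennreal (exp (t (i - 1) * enn2real (emeasure \<eta> (A' i)))))" for \<eta>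
  proof -
    have "ennreal (exp (X \<eta>)) = (\<Prod>i\<le>n. ennreal (exp (t i * enn2real (emeasure \<eta> (A i)))))"
      by (simp add: X_def exp_sum prod_ennreal)
    then show ?thesis unfolding reindex A'_def .
  qed
  then have "(\<integral>\<^sup>+\<eta>. ennreal (exp (X \<eta>)) \<partial>P)
      = (\<integral>\<^sup>+\<eta>. (\<Prod>i\<in>{1..Suc n}. ennreal (exp (t (i - 1) * enn2real (emeasure \<eta> (A' i))))) \<partial>P)"
    by (simp only:)
  also have "\<dots> = (\<Prod>i\<in>{1..Suc n}. \<integral>\<^sup>+\<eta>. ennreal (exp (t (i - 1) * enn2real (emeasure \<eta> (A' i)))) \<partial>P)"
    by (rule indep_vars_nn_integral[OF _ ind']) auto
  also have "\<dots> = (\<Prod>i\<le>n. ennreal (exp ((exp (t i) - 1) * measure lam (A i))))"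
    unfolding reindex A'_def using ne by (intro prod.cong) auto
  also have "\<dots> = ennreal (exp (\<Sum>i\<le>n. (exp (t i) - 1) * measure lam (A i)))"
    by (simp add: exp_sum prod_ennreal)
  finally have eq: "(\<integral>\<^sup>+\<eta>. ennreal (exp (X \<eta>)) \<partial>P) = ennreal (exp (\<Sum>i\<le>n. (exp (t i) - 1) * measure lam (A i)))" .
  then show "integrable P (\<lambda>\<eta>. exp (X \<eta>))" by (intro integrableI_nonneg) auto
  show "(\<integral>\<eta>. exp (X \<eta>) \<partial>P) = exp (\<Sum>i\<le>n. (exp (t i) - 1) * measure lam (A i))"
    using eq by (subst integral_eq_nn_integral) auto
qed

text \<open>By \<open>kl_integral_le\<close> it is enough that the divergence of the laws dominates
  each finite sum for the intensities; an exponential tilting by a linear statistic of the counts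
  produces that sum.\<close>

lemma poisson_pp_KL_ge:
  assumes lam: "sigma_finite_measure lam" and mu: "sigma_finite_measure mu"
    and P: "poisson_pp_dist lam P" and Q: "poisson_pp_dist mu Q"
    and f: "has_density nu lam f" and g: "has_density nu mu g"
    and p: "has_density m P p" and q: "has_density m Q q"
  shows "(\<integral>\<^sup>+x. kl_term (f x) (g x) \<partial>nu) \<le> (\<integral>\<^sup>+\<eta>. kl_term (p \<eta>) (q \<eta>) \<partial>m)"
proof (rule kl_integral_le[OF f g lam mu])
  fix n :: nat and A :: "nat \<Rightarrow> 'a set" and t :: "nat \<Rightarrow> real"
  assume A: "\<And>i. i \<le> n \<Longrightarrow> A i \<in> sets nu" "disjoint_family_on A {..n}"
    and fin: "\<And>i. i \<le> n \<Longrightarrow> emeasure lam (A i) < \<infinity>" "\<And>i. i \<le> n \<Longrightarrow> emeasure mu (A i) < \<infinity>"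
  interpret P: prob_space P using P by (rule poisson_pp_distD)
  interpret Q: prob_space Q using Q by (rule poisson_pp_distD)
  note [measurable] = has_densityD(1)[OF p] has_densityD(1)[OF q]
  have nn: "AE x in m. 0 \<le> p x" "AE x in m. 0 \<le> q x"
    using has_densityD(2)[OF p] has_densityD(2)[OF q] by auto
  have Pd: "P = density m (\<lambda>x. ennreal (p x))" and Qd: "Q = density m (\<lambda>x. ennreal (q x))"
    using p q by (auto simp: has_density_def)
  define X where "X = (\<lambda>\<eta>. \<Sum>i\<le>n. t i * enn2real (emeasure \<eta> (A i)))"
  \<comment> \<open>The logarithm of the mean of \<open>exp X\<close> under \<open>Q\<close>. With
    this normalization the \<open>q\<close> term of Young's inequality integrates to
    \<open>0\<close>, while the \<open>p\<close> term gives exactly the desired sum.\<close>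
  define c where "c = (\<Sum>i\<le>n. (exp (t i) - 1) * measure mu (A i))"
  have "A i \<in> sets lam" "A i \<in> sets mu" if "i \<le> n" for i
    using A(1)[OF that] has_densityD(3)[OF f] has_densityD(3)[OF g] by auto
  note XP = poisson_pp_linear_statistic[OF P this(1) A(2) fin(1), of t, folded X_def]
    and XQ = poisson_pp_linear_statistic[OF Q this(2) A(2) fin(2), of t, folded X_def c_def]
  have [measurable]: "X \<in> borel_measurable m"
    using XP(1) has_densityD(3)[OF p] by (simp cong: measurable_cong_sets)
  have "integrable P (\<lambda>\<eta>. X \<eta> - c)" "(\<integral>\<eta>. X \<eta> - c \<partial>P) = (\<Sum>i\<le>n. t i * measure lam (A i)) - c"
    using XP by (simp_all add: P.prob_space)
  then have i1: "integrable m (\<lambda>\<eta>. p \<eta> * (X \<eta> - c))"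
    "(\<integral>\<eta>. p \<eta> * (X \<eta> - c) \<partial>m) = (\<Sum>i\<le>n. t i * measure lam (A i)) - c"
    unfolding Pd using nn by (simp_all add: integrable_density integral_density)
  have "integrable Q (\<lambda>\<eta>. exp (X \<eta>))" "(\<integral>\<eta>. exp (X \<eta>) \<partial>Q) = exp c"
    using XQ(4,5) by (simp_all add: X_def)
  then have "integrable Q (\<lambda>\<eta>. exp (X \<eta> - c) - 1)" "(\<integral>\<eta>. exp (X \<eta> - c) - 1 \<partial>Q) = 0"
    by (simp_all add: exp_diff Q.prob_space)
  then have i2: "integrable m (\<lambda>\<eta>. q \<eta> * (exp (X \<eta> - c) - 1))" "(\<integral>\<eta>. q \<eta> * (exp (X \<eta> - c) - 1) \<partial>m) = 0"
    unfolding Qd using nn by (simp_all add: integrable_density integral_density)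
  let ?u = "\<lambda>\<eta>. p \<eta> * (X \<eta> - c) - q \<eta> * (exp (X \<eta> - c) - 1)"
  have iu: "integrable m ?u" using i1 i2 by simp
  have "(\<Sum>i\<le>n. t i * measure lam (A i) - (exp (t i) - 1) * measure mu (A i)) = (\<integral>\<eta>. ?u \<eta> \<partial>m)"
    using i1 i2 by (simp add: c_def sum_subtractf)
  \<comment> \<open>Passing to the positive part turns the Bochner integral into a nonnegative one,
    which can be compared with \<open>kl_term\<close>.\<close>
  also have "\<dots> \<le> (\<integral>\<eta>. max 0 (?u \<eta>) \<partial>m)" using iu by (intro integral_mono) auto
  finally have "ennreal (\<Sum>i\<le>n. t i * measure lam (A i) - (exp (t i) - 1) * measure mu (A i)) \<le> ennreal (\<integral>\<eta>. max 0 (?u \<eta>) \<partial>m)"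
    by (rule ennreal_leI)
  also have "\<dots> = (\<integral>\<^sup>+\<eta>. ennreal (max 0 (?u \<eta>)) \<partial>m)"
    using iu by (intro nn_integral_eq_integral[symmetric]) auto
  also have "\<dots> \<le> (\<integral>\<^sup>+\<eta>. kl_term (p \<eta>) (q \<eta>) \<partial>m)"
  proof (rule nn_integral_mono)
    fix \<eta> assume "\<eta> \<in> space m"
    then have "ennreal ((X \<eta> - c) * p \<eta> - (exp (X \<eta> - c) - 1) * q \<eta>) \<le> kl_term (p \<eta>) (q \<eta>)"
      using has_densityD(2)[OF p] has_densityD(2)[OF q] by (intro kl_term_young)
    then show "ennreal (max 0 (?u \<eta>)) \<le> kl_term (p \<eta>) (q \<eta>)"
      by (simp add: max_def mult.commute)
  qed
  finally show "ennreal (\<Sum>i\<le>n. t i * measure lam (A i) - (exp (t i) - 1) * measure mu (A i)) \<le> (\<integral>\<^sup>+\<eta>. kl_term (p \<eta>) (q \<eta>) \<partial>m)" .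
qed

section \<open>Upper bound for the divergence of the laws\<close>

lemma abs_exp_diff_le:
  fixes x y :: real
  assumes "\<bar>x\<bar> \<le> T" "\<bar>y\<bar> \<le> T"
  shows "\<bar>exp x - exp y\<bar> \<le> exp T * \<bar>x - y\<bar>"
proof -
  have *: "exp v - exp u \<le> exp T * (v - u)" if "u \<le> v" "v \<le> T" for u v :: real
  proof -
    have "exp v * (1 + (u - v)) \<le> exp v * exp (u - v)" by (intro mult_left_mono exp_ge_add_one_self) auto
    then have "exp v - exp u \<le> exp v * (v - u)" by (simp add: exp_diff algebra_simps)
    also have "\<dots> \<le> exp T * (v - u)" using that by (intro mult_right_mono) auto
    finally show ?thesis .
  qed
  show ?thesis using *[of x y] *[of y x] assms by (cases "x \<le> y") auto
qed

text \<open>On common disjoint sets \<open>D\<close>, \<open>F\<close> becomes a bounded function of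
  the count vector, whose laws are products of Poisson distributions. The cylinders may overlap, as
  those approximating disjoint events need not be disjoint.\<close>

lemma poisson_pp_cylinder_variational:
  fixes t :: "nat \<Rightarrow> real"
  assumes P: "poisson_pp_dist lam P" and Q: "poisson_pp_dist mu Q"
    and f: "has_density nu lam f" and g: "has_density nu mu g"
    and K: "(\<integral>\<^sup>+x. kl_term (f x) (g x) \<partial>nu) = ennreal K" "K \<ge> 0"
    and C: "\<And>j. j \<le> N \<Longrightarrow> cylinder nu (C j)"
  defines "F \<equiv> (\<lambda>\<eta>. \<Sum>j\<le>N. t j * indicator (C j) \<eta>)"
  shows "(\<integral>\<eta>. F \<eta> \<partial>P) - (\<integral>\<eta>. exp (F \<eta>) \<partial>Q) + 1 \<le> K"
proof -
  have sl: "sets lam = sets nu" and sm: "sets mu = sets nu"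
    using has_densityD(3)[OF f] has_densityD(3)[OF g] by auto
  obtain n D E where n: "n \<ge> 1" and D: "\<And>i. i \<in> {1..n} \<Longrightarrow> D i \<in> sets nu" "disjoint_family_on D {1..n}"
    and E: "\<And>j. j \<in> {..N} \<Longrightarrow> E j \<in> sets (\<Pi>\<^sub>M i\<in>{1..n}. borel)"
    and CE: "\<And>j. j \<in> {..N} \<Longrightarrow> C j = cylinder_over nu n D (E j)"
    by (rule cylinder_common[of "{..N}" nu C]) (use C in auto)
  define \<phi> where "\<phi> = (\<lambda>x. \<Sum>j\<le>N. t j * indicator (E j) x)"
  have \<phi>m [measurable]: "\<phi> \<in> borel_measurable (\<Pi>\<^sub>M i\<in>{1..n}. borel)"
    unfolding \<phi>_def using E by (intro borel_measurable_sum borel_measurable_times) auto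
  have em: "(\<lambda>x. exp (\<phi> x)) \<in> borel_measurable (\<Pi>\<^sub>M i\<in>{1..n}. borel)" by measurable
  have bdd: "\<bar>\<phi> x\<bar> \<le> (\<Sum>j\<le>N. \<bar>t j\<bar>)" for x
    unfolding \<phi>_def by (rule order_trans[OF sum_abs]) (auto intro!: sum_mono simp: indicator_def)
  let ?c = "\<lambda>\<eta>. \<lambda>i\<in>{1..n}. emeasure \<eta> (D i)"
  have F: "F \<eta> = \<phi> (?c \<eta>)" if "\<eta> \<in> point_patterns nu" for \<eta>
    unfolding F_def \<phi>_def using that
    by (intro sum.cong refl arg_cong2[where f = "(*)"]) (auto simp: CE cylinder_over_def indicator_def)
  have counts: "?c \<in> R \<rightarrow>\<^sub>M (\<Pi>\<^sub>M i\<in>{1..n}. borel)" "space R = point_patterns nu"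
    "distr R (\<Pi>\<^sub>M i\<in>{1..n}. borel) ?c = (\<Pi>\<^sub>M i\<in>{1..n}. poisson_ennreal (emeasure rho (D i)))"
    if R: "poisson_pp_dist rho R" "sets rho = sets nu" for R rho
  proof -
    have s: "sets R = sets (point_pattern_algebra nu)"
      using poisson_pp_distD(2)[OF R(1)] point_pattern_algebra_cong[OF R(2)] by simp
    show "?c \<in> R \<rightarrow>\<^sub>M (\<Pi>\<^sub>M i\<in>{1..n}. borel)"
      using measurable_counts[of "{1..n}" D nu, OF D(1)] s by (simp cong: measurable_cong_sets)
    show "space R = point_patterns nu"
      using sets_eq_imp_space_eq[OF s] by (simp add: space_point_pattern_algebra)
    show "distr R (\<Pi>\<^sub>M i\<in>{1..n}. borel) ?c = (\<Pi>\<^sub>M i\<in>{1..n}. poisson_ennreal (emeasure rho (D i)))"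
      using D R by (intro poisson_pp_distr_counts n) auto
  qed
  note cP = counts[OF P sl] and cQ = counts[OF Q sm]
  have "(\<integral>\<eta>. F \<eta> \<partial>P) = (\<integral>\<eta>. \<phi> (?c \<eta>) \<partial>P)"
    by (intro Bochner_Integration.integral_cong) (auto simp: F cP)
  also have "\<dots> = (\<integral>x. \<phi> x \<partial>(\<Pi>\<^sub>M i\<in>{1..n}. poisson_ennreal (emeasure lam (D i))))"
    unfolding cP(3)[symmetric] by (rule integral_distr[OF cP(1) \<phi>m, symmetric])
  finally have 1: "(\<integral>\<eta>. F \<eta> \<partial>P) = \<dots>" .
  have "(\<integral>\<eta>. exp (F \<eta>) \<partial>Q) = (\<integral>\<eta>. exp (\<phi> (?c \<eta>)) \<partial>Q)"
    by (intro Bochner_Integration.integral_cong) (auto simp: F cQ)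
  also have "\<dots> = (\<integral>x. exp (\<phi> x) \<partial>(\<Pi>\<^sub>M i\<in>{1..n}. poisson_ennreal (emeasure mu (D i))))"
    unfolding cQ(3)[symmetric] by (rule integral_distr[OF cQ(1) em, symmetric])
  finally have 2: "(\<integral>\<eta>. exp (F \<eta>) \<partial>Q) = \<dots>" .
  show ?thesis unfolding 1 2
    by (rule poisson_product_variational[OF f g _ D K \<phi>m bdd]) simp
qed

text \<open>If the right-hand side is finite, \<open>kl_integral_le\<close> for the laws leaves
  finite sums over disjoint events. Such a sum has the form \<open>E s - E (exp s) + 1\<close> for a
  simple function \<open>s\<close>, with the first mean under \<open>P\<close> and the second under
  \<open>Q\<close>. This form depends continuously on the events, so they can be replaced by
  cylinders.\<close>

lemma poisson_pp_KL_le: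
  assumes P: "poisson_pp_dist lam P" and Q: "poisson_pp_dist mu Q"
    and f: "has_density nu lam f" and g: "has_density nu mu g"
    and p: "has_density m P p" and q: "has_density m Q q"
  shows "(\<integral>\<^sup>+\<eta>. kl_term (p \<eta>) (q \<eta>) \<partial>m) \<le> (\<integral>\<^sup>+x. kl_term (f x) (g x) \<partial>nu)"
proof (cases "(\<integral>\<^sup>+x. kl_term (f x) (g x) \<partial>nu)" rule: ennreal_cases)
  case K: (real K)
  interpret P: prob_space P using P by (rule poisson_pp_distD)
  interpret Q: prob_space Q using Q by (rule poisson_pp_distD)
  have sP: "sets P = sets (point_pattern_algebra nu)" and sQ: "sets Q = sets (point_pattern_algebra nu)"
    using poisson_pp_distD(2)[OF P] poisson_pp_distD(2)[OF Q]
      point_pattern_algebra_cong has_densityD(3)[OF f] has_densityD(3)[OF g] by metis+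
  show ?thesis unfolding K(2)
  proof (rule kl_integral_le[OF p q P.sigma_finite_measure_axioms Q.sigma_finite_measure_axioms], rule ennreal_leI)
    fix n :: nat and A :: "nat \<Rightarrow> 'a measure set" and t :: "nat \<Rightarrow> real"
    assume Am: "\<And>i. i \<le> n \<Longrightarrow> A i \<in> sets m" and disj: "disjoint_family_on A {..n}"
    have A [measurable]: "A i \<in> sets P" "A i \<in> sets Q" if "i \<le> n" for i
      using Am[OF that] has_densityD(3)[OF p] has_densityD(3)[OF q] by auto
    define T where "T = (\<Sum>i\<le>n. \<bar>t i\<bar>)"
    \<comment> \<open>The family of events is an argument, since \<open>s\<close> is compared for
      the given events and for the approximating cylinders. The bound \<open>T\<close> holds for
      every family.\<close>
    define s where "s = (\<lambda>A \<eta>. \<Sum>i\<le>n. t i * indicator (A i :: 'a measure set) \<eta>)"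
    have bdd: "\<bar>s A \<eta>\<bar> \<le> T" for A \<eta>
      unfolding s_def T_def by (rule order_trans[OF sum_abs]) (auto intro!: sum_mono simp: indicator_def)
    \<comment> \<open>\<open>R\<close> is the sum of \<open>P\<close> and \<open>Q\<close>, so one
      cylinder approximates an event under both laws at once.\<close>
    define R where "R = density m (\<lambda>x. ennreal (p x + q x))"
    note ref = ereal_integral_change_reference(1,2)[OF p q, folded R_def]
    have R: "finite_measure R" "sets R = sets (point_pattern_algebra nu)" "sets R = sets m"
      "\<And>B. B \<in> sets P \<Longrightarrow> measure R B = measure P B + measure Q B"
    proof -
      have "emeasure R (space R) = emeasure P (space P) + emeasure Q (space P)"
        using ref(2)[of "space P"] sets_eq_imp_space_eq[OF ref(1)] by simp
      then show "finite_measure R" by (intro finite_measureI) simp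
      show "sets R = sets (point_pattern_algebra nu)" "sets R = sets m"
        using ref(1) sP has_densityD(3)[OF p] by auto
      show "measure R B = measure P B + measure Q B" if "B \<in> sets P" for B
        using ref(2)[OF that] by (simp add: measure_def enn2real_plus less_top[symmetric])
    qed
    let ?S = "\<Sum>i\<le>n. t i * measure P (A i) - (exp (t i) - 1) * measure Q (A i)"
    have "?S \<le> K + \<epsilon>" if "\<epsilon> > 0" for \<epsilon>
    proof -
      \<comment> \<open>The replacement costs \<open>T * \<delta>\<close> in the first mean and
        \<open>exp T * (T * \<delta>)\<close> in the second, where \<open>exp T\<close> is a
        Lipschitz constant of \<open>exp\<close> on the range of \<open>s\<close>. Using
        \<open>T + 1\<close> keeps the denominator positive for \<open>T = 0\<close>.\<close>
      define \<delta> where "\<delta> = \<epsilon> / ((T + 1) * (1 + exp T))"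
      have T0: "T \<ge> 0" by (simp add: T_def sum_nonneg)
      then have "\<delta> > 0" using that by (simp add: \<delta>_def add_pos_pos)
      have "\<exists>C. cylinder nu C \<and> measure P ((A i - C) \<union> (C - A i)) < \<delta> \<and> measure Q ((A i - C) \<union> (C - A i)) < \<delta>"
        if i: "i \<le> n" for i
      proof -
        obtain C where C: "cylinder nu C" "measure R ((A i - C) \<union> (C - A i)) < \<delta>"
          using approximation_by_cylinders[OF R(1,2) _ \<open>\<delta> > 0\<close>] Am[OF i] R(3) by metis
        have Cm [measurable]: "C \<in> sets P" using cylinder_measurable[OF C(1)] sP by simp
        have "(A i - C) \<union> (C - A i) \<in> sets P" using A[OF i] by auto
        then have "measure P ((A i - C) \<union> (C - A i)) + measure Q ((A i - C) \<union> (C - A i)) < \<delta>"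
          using C(2) R(4) by simp
        then have "measure P ((A i - C) \<union> (C - A i)) < \<delta>" "measure Q ((A i - C) \<union> (C - A i)) < \<delta>"
          by (meson add_strict_increasing add_strict_increasing2 le_add_same_cancel1 le_add_same_cancel2 le_less_trans measure_nonneg)+
        with C(1) show ?thesis by blast
      qed
      then obtain C where C: "\<And>i. i \<le> n \<Longrightarrow> cylinder nu (C i)"
        "\<And>i. i \<le> n \<Longrightarrow> measure P ((A i - C i) \<union> (C i - A i)) < \<delta>"
        "\<And>i. i \<le> n \<Longrightarrow> measure Q ((A i - C i) \<union> (C i - A i)) < \<delta>" by metis
      have Cm [measurable]: "C i \<in> sets P" "C i \<in> sets Q" if "i \<le> n" for i
        using cylinder_measurable[OF C(1)[OF that]] sP sQ by auto
      have sm: "s B \<in> borel_measurable P" if "\<And>i. i \<le> n \<Longrightarrow> B i \<in> sets P" for B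
        unfolding s_def using that by (intro borel_measurable_sum borel_measurable_times) auto
      have sPQ: "sets P = sets Q" using sP sQ by simp
      let ?d = "\<lambda>\<eta>. \<Sum>i\<le>n. \<bar>t i\<bar> * indicator ((A i - C i) \<union> (C i - A i)) \<eta>"
      have diff: "\<bar>s A \<eta> - s C \<eta>\<bar> \<le> ?d \<eta>" for \<eta>
      proof -
        have "\<bar>s A \<eta> - s C \<eta>\<bar> \<le> (\<Sum>i\<le>n. \<bar>t i * indicator (A i) \<eta> - t i * indicator (C i) \<eta>\<bar>)"
          unfolding s_def sum_subtractf[symmetric] by (rule sum_abs)
        also have "\<dots> \<le> ?d \<eta>" by (intro sum_mono) (auto simp: indicator_def)
        finally show ?thesis .
      qed
      have small: "integrable N ?d" "(\<integral>\<eta>. ?d \<eta> \<partial>N) \<le> T * \<delta>"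
        if N: "prob_space N" "sets N = sets P"
          "\<And>i. i \<le> n \<Longrightarrow> measure N ((A i - C i) \<union> (C i - A i)) < \<delta>" for N
      proof -
        interpret N: prob_space N by fact
        have Sm: "(A i - C i) \<union> (C i - A i) \<in> sets N" if "i \<le> n" for i
          using A[OF that] Cm[OF that] N(2) by auto
        then have i: "integrable N (\<lambda>\<eta>. \<bar>t i\<bar> * indicator ((A i - C i) \<union> (C i - A i)) \<eta>)" if "i \<le> n" for i
          by (intro integrable_mult_right integrable_real_indicator Sm that) (simp add: less_top[symmetric])
        then show "integrable N ?d" by (intro Bochner_Integration.integrable_sum) simp
        have "(\<integral>\<eta>. ?d \<eta> \<partial>N) = (\<Sum>i\<le>n. \<bar>t i\<bar> * measure N ((A i - C i) \<union> (C i - A i)))"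
        proof (subst Bochner_Integration.integral_sum)
          show "(\<Sum>i\<le>n. \<integral>\<eta>. \<bar>t i\<bar> * indicator ((A i - C i) \<union> (C i - A i)) \<eta> \<partial>N)
              = (\<Sum>i\<le>n. \<bar>t i\<bar> * measure N ((A i - C i) \<union> (C i - A i)))"
            using Sm by (intro sum.cong refl) (simp add: N.emeasure_eq_measure)
        qed (use i in simp)
        also have "\<dots> \<le> (\<Sum>i\<le>n. \<bar>t i\<bar> * \<delta>)"
          by (intro sum_mono mult_left_mono less_imp_le[OF N(3)]) auto
        finally show "(\<integral>\<eta>. ?d \<eta> \<partial>N) \<le> T * \<delta>" by (simp add: T_def sum_distrib_right)
      qed
      note dP = small[OF P.prob_space_axioms refl C(2)] and dQ = small[OF Q.prob_space_axioms sPQ[symmetric] C(3)]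
      have sint: "integrable P (s B)" "integrable Q (\<lambda>\<eta>. exp (s B \<eta>))"
        if "\<And>i. i \<le> n \<Longrightarrow> B i \<in> sets P" for B
      proof -
        have [measurable]: "s B \<in> borel_measurable P" "s B \<in> borel_measurable Q"
          using sm[OF that] sPQ by (auto cong: measurable_cong_sets)
        show "integrable P (s B)" using bdd by (intro P.integrable_const_bound[of _ T]) auto
        show "integrable Q (\<lambda>\<eta>. exp (s B \<eta>))"
          using bdd by (intro Q.integrable_const_bound[of _ "exp T"]) (auto intro: abs_le_D1)
      qed
      note iA = sint[OF A(1)] and iC = sint[OF Cm(1)]
      \<comment> \<open>Here disjointness enters: at most one summand of \<open>s A\<close> is
        active at each point, so its exponential is again an explicit simple function.\<close>
      have exp_s: "exp (s A \<eta>) = 1 + (\<Sum>i\<le>n. (exp (t i) - 1) * indicator (A i) \<eta>)" for \<eta>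
      proof (cases "\<exists>j\<le>n. \<eta> \<in> A j")
        case True
        then obtain j where j: "j \<le> n" "\<eta> \<in> A j" by blast
        have "(\<Sum>i\<le>n. h i * indicator (A i) \<eta>) = (\<Sum>i\<le>n. if i = j then h j else 0)" for h :: "nat \<Rightarrow> real"
          using j disj by (intro sum.cong) (auto simp: disjoint_family_on_def indicator_def)
        then have "(\<Sum>i\<le>n. h i * indicator (A i) \<eta>) = h j" for h :: "nat \<Rightarrow> real"
          using j by simp
        then show ?thesis by (simp add: s_def)
      next
        case False
        then have "(\<Sum>i\<le>n. h i * indicator (A i) \<eta>) = 0" for h :: "nat \<Rightarrow> real"
          by (intro sum.neutral) (auto simp: indicator_def)
        then show ?thesis by (simp add: s_def)
      qed
      have "(\<integral>\<eta>. s A \<eta> \<partial>P) = (\<Sum>i\<le>n. t i * measure P (A i))"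
        unfolding s_def using A(1) by (subst Bochner_Integration.integral_sum) (auto simp: less_top[symmetric])
      moreover have "(\<integral>\<eta>. exp (s A \<eta>) \<partial>Q) = 1 + (\<Sum>i\<le>n. (exp (t i) - 1) * measure Q (A i))"
      proof -
        have i: "integrable Q (\<lambda>\<eta>. (exp (t i) - 1) * indicator (A i) \<eta>)" if "i \<le> n" for i
          using A(2)[OF that] by (intro integrable_mult_right) (auto simp: less_top[symmetric])
        then have "integrable Q (\<lambda>\<eta>. \<Sum>i\<le>n. (exp (t i) - 1) * indicator (A i) \<eta>)"
          by (intro Bochner_Integration.integrable_sum) simp
        then have "(\<integral>\<eta>. exp (s A \<eta>) \<partial>Q) = 1 + (\<integral>\<eta>. (\<Sum>i\<le>n. (exp (t i) - 1) * indicator (A i) \<eta>) \<partial>Q)"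
          unfolding exp_s by (subst Bochner_Integration.integral_add) (simp_all add: Q.prob_space)
        also have "(\<integral>\<eta>. (\<Sum>i\<le>n. (exp (t i) - 1) * indicator (A i) \<eta>) \<partial>Q) = (\<Sum>i\<le>n. \<integral>\<eta>. (exp (t i) - 1) * indicator (A i) \<eta> \<partial>Q)"
          using i by (intro Bochner_Integration.integral_sum) simp
        also have "\<dots> = (\<Sum>i\<le>n. (exp (t i) - 1) * measure Q (A i))"
          using A(2) by (intro sum.cong) auto
        finally show ?thesis .
      qed
      ultimately have S: "?S = (\<integral>\<eta>. s A \<eta> \<partial>P) - (\<integral>\<eta>. exp (s A \<eta>) \<partial>Q) + 1"
        by (simp add: sum_subtractf)
      have "(\<integral>\<eta>. s A \<eta> \<partial>P) - (\<integral>\<eta>. s C \<eta> \<partial>P) = (\<integral>\<eta>. s A \<eta> - s C \<eta> \<partial>P)" using iA iC by simp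
      also have "\<dots> \<le> (\<integral>\<eta>. ?d \<eta> \<partial>P)"
        using iA iC dP(1) diff by (intro integral_mono Bochner_Integration.integrable_diff) (auto intro: abs_le_D1)
      also note dP(2)
      finally have 1: "(\<integral>\<eta>. s A \<eta> \<partial>P) \<le> (\<integral>\<eta>. s C \<eta> \<partial>P) + T * \<delta>" by simp
      have "(\<integral>\<eta>. exp (s C \<eta>) \<partial>Q) - (\<integral>\<eta>. exp (s A \<eta>) \<partial>Q) = (\<integral>\<eta>. exp (s C \<eta>) - exp (s A \<eta>) \<partial>Q)" using iA iC by simp
      also have "\<dots> \<le> (\<integral>\<eta>. exp T * ?d \<eta> \<partial>Q)"
      proof (intro integral_mono Bochner_Integration.integrable_diff integrable_mult_right iA iC dQ)
        fix \<eta>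
        have "exp (s C \<eta>) - exp (s A \<eta>) \<le> exp T * \<bar>s A \<eta> - s C \<eta>\<bar>"
          using abs_exp_diff_le[OF bdd bdd, of C \<eta> A \<eta>] by (simp add: abs_minus_commute)
        also have "\<dots> \<le> exp T * ?d \<eta>" using diff by (intro mult_left_mono) auto
        finally show "exp (s C \<eta>) - exp (s A \<eta>) \<le> exp T * ?d \<eta>" .
      qed
      also have "\<dots> = exp T * (\<integral>\<eta>. ?d \<eta> \<partial>Q)" by (rule integral_mult_right_zero)
      also have "\<dots> \<le> exp T * (T * \<delta>)" using dQ(2) by (intro mult_left_mono) auto
      finally have 2: "(\<integral>\<eta>. exp (s C \<eta>) \<partial>Q) \<le> (\<integral>\<eta>. exp (s A \<eta>) \<partial>Q) + exp T * (T * \<delta>)" by simp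
      have "?S \<le> ((\<integral>\<eta>. s C \<eta> \<partial>P) - (\<integral>\<eta>. exp (s C \<eta>) \<partial>Q) + 1) + T * \<delta> + exp T * (T * \<delta>)"
        using S 1 2 by linarith
      also have "(\<integral>\<eta>. s C \<eta> \<partial>P) - (\<integral>\<eta>. exp (s C \<eta>) \<partial>Q) + 1 \<le> K"
        unfolding s_def using C(1) by (rule poisson_pp_cylinder_variational[OF P Q f g K(2,1)])
      also have "K + T * \<delta> + exp T * (T * \<delta>) = K + T * (1 + exp T) * \<delta>" by (simp add: algebra_simps)
      also have "T * (1 + exp T) * \<delta> \<le> (T + 1) * (1 + exp T) * \<delta>"
        using \<open>\<delta> > 0\<close> by (intro mult_right_mono) (auto intro: add_nonneg_nonneg)
      also have "(T + 1) * (1 + exp T) * \<delta> = \<epsilon>"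
      proof -
        have "(T + 1) * (1 + exp T) > 0" using T0 by (intro mult_pos_pos add_nonneg_pos add_pos_pos) auto
        then have "(T + 1) * (1 + exp T) \<noteq> 0" by linarith
        then show ?thesis unfolding \<delta>_def times_divide_eq_right by (rule nonzero_mult_div_cancel_left)
      qed
      finally show ?thesis by simp
    qed
    then show "?S \<le> K" by (rule field_le_epsilon)
  qed
qed simp

theorem theorem5p2:
  fixes S lam mu nu :: "'a measure"
    and P_lam P_mu :: "'a measure measure"
    and f g :: "'a \<Rightarrow> real"
  assumes "sets lam = sets S" and "sets mu = sets S" and "sets nu = sets S"
    and "sigma_finite_measure lam" and "sigma_finite_measure mu"
    and "poisson_pp_dist lam P_lam" and "poisson_pp_dist mu P_mu"
    and "has_density nu lam f" and "has_density nu mu g"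
  shows "KL_div P_lam P_mu =
    ereal_integral nu (\<lambda>x. log_term (f x) (g x) + ereal (g x) - ereal (f x))"
proof -
  have "sets P_lam = sets P_mu"
    using assms(1,2) poisson_pp_distD(2)[OF assms(6)] poisson_pp_distD(2)[OF assms(7)]
      point_pattern_algebra_cong[of lam mu] by simp
  then obtain m p q where m: "sigma_finite_measure m" "has_density m P_lam p" "has_density m P_mu q"
    using ex_dominating_measure poisson_pp_distD(1)[OF assms(6)] poisson_pp_distD(1)[OF assms(7)] by blast
  have "KL_div P_lam P_mu = enn2ereal (\<integral>\<^sup>+\<eta>. kl_term (p \<eta>) (q \<eta>) \<partial>m)"
    by (rule KL_div_eq_kl_term[OF poisson_pp_distD(1)[OF assms(6)] poisson_pp_distD(1)[OF assms(7)] m])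
  also have "(\<integral>\<^sup>+\<eta>. kl_term (p \<eta>) (q \<eta>) \<partial>m) = (\<integral>\<^sup>+x. kl_term (f x) (g x) \<partial>nu)"
    using poisson_pp_KL_le[OF assms(6-9) m(2,3)] poisson_pp_KL_ge[OF assms(4-9) m(2,3)] by (rule antisym)
  finally show ?thesis by (simp add: ereal_integral_kl_term[OF assms(8,9)])
qed

end
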